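(* Let $h \geq 2$ and $k \geq 5$ be positive integers. Let $A$ be a set of $k$ integers with $\min(A)=0$ and $d(A)=1$. Then: (1) For $k\geq 6$, $|2A|=2k+2$ if and only if $A=[0,k+2]\setminus\{x,y,z\}$, where $\{x,y,z\}$ is one of the sets $\{2,3,k+2\}$, $\{k-2,k-1,k+2\}$, $\{1,i,k+2\}$ where $4\leq i\leq k-1$, $\{i,k,k+2\}$ where $2\leq i\leq k-3$, $\{1,2,3\}$, $\{k-1,k,k+1\}$, $\{1,2,4\}$, $\{k-2,k,k+1\}$, $\{1,2,k+1\}$, $\{1,k,k+1\}$, $\{1,2,5\}$, $\{k-3,k,k+1\}$, $\{1,3,5\}$, $\{k-3,k-1,k+1\}$, $\{1,3,k+1\}$, $\{1,k-1,k+1\}$, and $\{2,3,k+2\}$. (2) $|3A|=3k+4$ if and only if $A=[0,k+2]\setminus\{x,y,z\}$, where $\{x,y,z\}$ is one of the sets $\{1,2,3\}$, $\{k-1,k,k+1\}$, $\{1,2,4\}$, $\{k-2,k,k+1\}$, $\{1,2,k+1\}$, $\{1,k,k+1\}$, $\{1,2,5\}$, $\{k-3,k,k+1\}$, $\{1,3,5\}$, $\{k-3,k-1,k+1\}$, $\{1,3,k+1\}$, $\{1,k-1,k+1\}$, and $\{i,j,k+2\}$ where $2\leq i<j\leq k-1$. (3) For $h\geq 4$, $|hA|=hk+2h-2$ if and only if $A=[0,k+2]\setminus\{x,y,z\}$, where $\{x,y,z\}$ is one of the sets $\{1,2,3\}$, $\{k-1,k,k+1\}$, $\{1,2,4\}$,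 $\{k-2,k,k+1\}$, $\{1,2,k+1\}$, $\{1,k,k+1\}$, $\{1,2,5\}$, $\{k-3,k,k+1\}$, $\{1,3,5\}$, $\{k-3,k-1,k+1\}$, $\{1,3,k+1\}$, and $\{1,k-1,k+1\}$. (4) For $h\geq 4$ and $k\geq 5$, or $h\geq 3$ and $k\geq 6$, $|hA|=hk+2h-1$ if and only if $A=[0,k+2]\setminus\{x,y,z\}$, where $\{x,y,z\}$ is one of the sets $\{1,3,4\}$, $\{k-2,k-1,k+1\}$, $\{1,2,i\}$ where $6\leq i\leq k$, $\{i,k,k+1\}$ where $2\leq i\leq k-4$, $\{1,3,i\}$ where $6\leq i\leq k$, $\{i,k-1,k+1\}$ where $2\leq i\leq k-4$, and $\{1,i,k+1\}$ where $4\leq i\leq k-2$. (5) For $h\geq 4$ and $k\geq 6$, or $h\geq 5$ and $k\geq 5$, $|hA|=hk+2h$ if and only if $A=[0,k+2]\setminus\{x,y,z\}$, where $\{x,y,z\}$ is one of the sets $\{2,3,k+1\}$, $\{1,k-1,k\}$, $\{i,i+1,k+1\}$ where $3\leq i\leq k-4$, $\{1,i,i+1\}$ where $5\leq i\leq k-2$, $\{i,i+2,k+1\}$ where $2\leq i\leq k-4$, $\{1,i,i+2\}$ where $4\leq i\leq k-2$, $\{1,i,j\}$ where $4\leq i\leq j-3\leq k-3$, and $\{i,j,k+1\}$ where $2\leq i\leq j-3\leq k-5$. (6) For $h\geq 5$ and $k\geq 6$, or $h\geq 6$ and $k\geq 5$, $|hA|=hk+2h+1$ if and only if $A=[0,k+2]\setminus\{x,y,z\}$,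 where $2\leq x<y<z\leq k$.
   Context: For a nonempty finite set $A$ of integers and a positive integer $h$, the $h$-fold sumset $hA$ is the set of all sums of $h$ (not necessarily distinct) elements of $A$; $|A|$ denotes the cardinality of $A$. For integers $\alpha\leq\beta$, $[\alpha,\beta]=\{\alpha,\alpha+1,\ldots,\beta\}$. For $A=\{a_0<a_1<\cdots<a_{k-1}\}$, $d(A)=\gcd(a_1-a_0,a_2-a_0,\ldots,a_{k-1}-a_0)$. The letters $i,j,x,y,z$ denote integers.
   Formalization: In (5) the ranges for {i,i+1,k+1} and {1,i,i+1} are corrected to 3≤i≤k-3 and 4≤i≤k-2, adding {k-3,k-2,k+1} and {1,4,5}; as printed (5) fails for every k≥6, e.g. k=6, h=4, A={0,2,3,6,7,8} has |4A|=32=hk+2h. *)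

theory Defs
  imports Main "HOL-Library.FuncSet"
begin

definition hfold_sumset :: "nat \<Rightarrow> int set \<Rightarrow> int set" where
  "hfold_sumset h A = {\<Sum>i<h. f i | f. f \<in> {..<h} \<rightarrow> A}"

definition diff_gcd :: "int set \<Rightarrow> int" where
  "diff_gcd A = Gcd ((\<lambda>a. a - Min A) ` (A - {Min A}))"

(* In the fifth equivalence (|hA| = hk + 2h) of the theorem, the families {i, i + 1, k + 1} and {1, i, i + 1} are taken for
   3 <= i <= k - 3 and 4 <= i <= k - 2.  The source prints 3 <= i <= k - 4 and 5 <= i <= k - 2;
   this omits {k - 3, k - 2, k + 1} and {1, 4, 5}, and the equivalence then fails for every
   k >= 6: for instance, k = 6, A = {0, 2, 3, 6, 7, 8} and h = 4 give |4A| = 32 = hk + 2h. *)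

end

theory Submission
  imports Defs
begin

text \<open>
  Let $d = \max A$. Since $hA$ and $hA + d$ both lie in $(h+1)A$, counting each residue class
  modulo $d$ gives $|(h+1)A| \ge |hA| + |(h+1)A \bmod d|$, and modulo $d$ every further summand $A$
  contributes at least two new residues until all residues are reached. Together with Freiman's
  lower bound for $|2A|$, obtained by removing the largest or, after reflection, the smallest
  element, this yields $|hA| \ge hk + 3h - 4$ (and $hk + 3h - 3$ for $k \ge 6$) once
  $d \ge k + 3$, which exceeds every cardinality in the theorem. If $d \le k + 2$, then $A$ is an
  interval with at most three elements missing, $hA$ contains the whole of $[d, (h-1)d]$, and the
  gaps of $hA$ below $d$ and, by reflection, above $(h-1)d$ can be read off from the missing elements.
\<close>

section \<open>Iterated sumsets\<close>

text \<open>The obstacle is h = 2. Counting residues gives only |2A| >= 2k + 1, since 2A is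
  guaranteed just two residues beyond the k - 1 of A, while every later step gains k + 3. The start
  must be 2k + 2 for k = 5 and 2k + 3 for k >= 6. These are the values of Freiman's 3k - 3 at k = 5
  and k = 6, so 3k - 3 is proved for those sizes, and for k >= 7 the weaker 2k + 3 is carried by
  induction.

  The conditions on h and k in the last three equivalences mark where the bounds for d >= k + 3
  overtake the cardinality in question: hk + 3h - 4 exceeds hk + 2h - 1, hk + 2h, hk + 2h + 1 from h
  = 4, 5, 6 on, and hk + 3h - 3, available for k >= 6, already from h = 3, 4, 5 on.

  For d <= k + 2, the condition k >= 5 means k + 2 < 2k - 2; this density makes 2A meet every
  residue modulo d and leaves gaps of hA only near the two ends.\<close>

lemma hfold_sumset_0 [simp]: "hfold_sumset 0 A = {0}"
  by (auto simp: hfold_sumset_def)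

lemma hfold_sumset_Suc:
  "hfold_sumset (Suc h) A = {s + a |s a. s \<in> hfold_sumset h A \<and> a \<in> A}"
proof (intro set_eqI iffI)
  fix n assume "n \<in> hfold_sumset (Suc h) A"
  then obtain f where f: "f \<in> {..<Suc h} \<rightarrow> A" "n = (\<Sum>i<Suc h. f i)"
    by (auto simp: hfold_sumset_def)
  have "(\<Sum>i<h. f i) \<in> hfold_sumset h A"
    unfolding hfold_sumset_def using f(1) by (intro CollectI exI[of _ f]) auto
  then show "n \<in> {s + a |s a. s \<in> hfold_sumset h A \<and> a \<in> A}"
    using f by auto
next
  fix n assume "n \<in> {s + a |s a. s \<in> hfold_sumset h A \<and> a \<in> A}"
  then obtain f a where f: "f \<in> {..<h} \<rightarrow> A" "a \<in> A" "n = (\<Sum>i<h. f i) + a"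
    by (auto simp: hfold_sumset_def)
  have "n = (\<Sum>i<Suc h. (f(h := a)) i)"
    using f(3) by simp
  moreover have "f(h := a) \<in> {..<Suc h} \<rightarrow> A"
    using f by (auto simp: less_Suc_eq)
  ultimately show "n \<in> hfold_sumset (Suc h) A"
    unfolding hfold_sumset_def by blast
qed

lemma hfold_sumset_1 [simp]: "hfold_sumset (Suc 0) A = A"
  by (auto simp: hfold_sumset_Suc)

lemma hfold_sumset_2: "hfold_sumset 2 A = {a + b |a b. a \<in> A \<and> b \<in> A}"
  by (simp add: numeral_2_eq_2 hfold_sumset_Suc[of "Suc 0"])

lemma hfold_sumset_3:
  "hfold_sumset 3 A = {a + b + c |a b c. a \<in> A \<and> b \<in> A \<and> c \<in> A}"
proof -
  have "hfold_sumset 3 A = {s + a |s a. s \<in> hfold_sumset 2 A \<and> a \<in> A}"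
    using hfold_sumset_Suc[of 2 A] by simp
  then show ?thesis by (auto simp: hfold_sumset_2)
qed

lemma finite_hfold_sumset [simp]: "finite A \<Longrightarrow> finite (hfold_sumset h A)"
proof (induction h)
  case (Suc h)
  have "hfold_sumset (Suc h) A = (\<lambda>(s, a). s + a) ` (hfold_sumset h A \<times> A)"
    by (auto simp: hfold_sumset_Suc)
  with Suc show ?case by simp
qed simp

lemma hfold_sumset_Suc_subset: "0 \<in> A \<Longrightarrow> hfold_sumset h A \<subseteq> hfold_sumset (Suc h) A"
  by (force simp: hfold_sumset_Suc)

lemma hfold_sumset_mono_fold:
  "0 \<in> A \<Longrightarrow> g \<le> h \<Longrightarrow> hfold_sumset g A \<subseteq> hfold_sumset h A"
  by (rule lift_Suc_mono_le[of "\<lambda>h. hfold_sumset h A"]) (auto dest: hfold_sumset_Suc_subset)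

lemma hfold_sumset_add_closed:
  assumes "A \<subseteq> G" "0 \<in> G" "\<And>x y. x \<in> G \<Longrightarrow> y \<in> G \<Longrightarrow> x + y \<in> G"
  shows "hfold_sumset h A \<subseteq> G"
  by (induction h) (use assms in \<open>auto simp: hfold_sumset_Suc\<close>)

lemma hfold_sumset_subset_atLeastAtMost:
  "A \<subseteq> {0..d} \<Longrightarrow> hfold_sumset h A \<subseteq> {0..int h * d}"
  by (induction h) (fastforce simp: hfold_sumset_Suc algebra_simps)+

lemma hfold_sumset_add:
  "s \<in> hfold_sumset g A \<Longrightarrow> t \<in> hfold_sumset h A \<Longrightarrow> s + t \<in> hfold_sumset (g + h) A"
proof (induction h arbitrary: t)
  case (Suc h)
  then obtain u a where "t = u + a" "u \<in> hfold_sumset h A" "a \<in> A"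
    by (auto simp: hfold_sumset_Suc)
  moreover have "s + u \<in> hfold_sumset (g + h) A"
    using Suc \<open>u \<in> hfold_sumset h A\<close> by blast
  ultimately show ?case
    by (simp add: hfold_sumset_Suc) (metis add.assoc)
qed simp

lemma mult_mem_hfold_sumset: "d \<in> A \<Longrightarrow> int h * d \<in> hfold_sumset h A"
proof (induction h)
  case (Suc h)
  have "int (Suc h) * d = int h * d + d" by (simp add: algebra_simps)
  with Suc show ?case unfolding hfold_sumset_Suc by blast
qed simp

lemma hfold_sumset_reflect:
  "hfold_sumset h ((\<lambda>a. d - a) ` A) = (\<lambda>n. int h * d - n) ` hfold_sumset h A"
proof (induction h)
  case (Suc h)
  have "hfold_sumset (Suc h) ((\<lambda>a. d - a) ` A)
      = {(int h * d - s) + (d - a) |s a. s \<in> hfold_sumset h A \<and> a \<in> A}"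
    unfolding hfold_sumset_Suc Suc by blast
  also have "\<dots> = (\<lambda>n. int (Suc h) * d - n) ` hfold_sumset (Suc h) A"
    unfolding hfold_sumset_Suc
    by (force simp: algebra_simps image_iff)
  finally show ?case .
qed simp

lemma card_hfold_sumset_reflect:
  "card (hfold_sumset h ((\<lambda>a. d - a) ` A)) = card (hfold_sumset h A)"
  unfolding hfold_sumset_reflect by (rule card_image) (auto simp: inj_on_def)

text \<open>When the minimum is 0, \<open>diff_gcd A\<close> is the gcd of \<open>A\<close>. The
  maximum \<open>d\<close> is a parameter because it serves as the modulus and because the
  reflection \<open>a -> d - a\<close> preserves the predicate with the same
  \<open>d\<close>.\<close>

definition normalized :: "int set \<Rightarrow> int \<Rightarrow> bool" where
  "normalized A d \<longleftrightarrow> A \<subseteq> {0..d} \<and> 0 \<in> A \<and> d \<in> A \<and> Gcd A = 1"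

lemma normalizedD:
  assumes "normalized A d"
  shows "finite A" "A \<subseteq> {0..d}" "0 \<in> A" "d \<in> A" "Gcd A = 1" "d > 0"
proof -
  from assms show *: "A \<subseteq> {0..d}" "0 \<in> A" "d \<in> A" "Gcd A = 1"
    by (auto simp: normalized_def)
  show "finite A" using *(1) finite_subset by blast
  have "d \<noteq> 0"
  proof
    assume "d = 0"
    with * have "A = {0}" by auto
    with *(4) show False by simp
  qed
  with * show "d > 0" by auto
qed

text \<open>Both sets contain \<open>d\<close>, so a common divisor of either one divides
  \<open>d\<close> and hence all differences \<open>d - a\<close>.\<close>

lemma Gcd_reflect:
  fixes A :: "int set"
  assumes "0 \<in> A" "d \<in> A"
  shows "Gcd ((\<lambda>a. d - a) ` A) = Gcd A"
proof -
  have "c dvd Gcd ((\<lambda>a. d - a) ` A) \<longleftrightarrow> c dvd Gcd A" for c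
  proof -
    have "(\<forall>a\<in>A. c dvd d - a) \<longleftrightarrow> (\<forall>a\<in>A. c dvd a)"
      using assms by (metis diff_0_right dvd_diff_commute dvd_diff dvd_diff_right_iff)
    then show ?thesis by (simp add: dvd_Gcd_iff)
  qed
  then show ?thesis
    by (metis Gcd_int_greater_eq_0 dvd_refl zdvd_antisym_nonneg)
qed

lemma normalized_reflect:
  assumes "normalized A d"
  shows "normalized ((\<lambda>a. d - a) ` A) d"
proof -
  note A = normalizedD[OF assms]
  show ?thesis
    unfolding normalized_def using A Gcd_reflect[OF A(3,4)] by (auto simp: image_iff)
qed

lemma card_reflect: "card ((\<lambda>a::int. d - a) ` A) = card A"
  by (rule card_image) (auto simp: inj_on_def)

text \<open>The least element of each residue class of $(h+1)A$ lies outside $hA + d$.\<close>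
lemma card_hfold_sumset_Suc_ge:
  fixes d :: int
  assumes "finite A" "0 \<in> A" "d \<in> A" "d > 0"
  shows "card (hfold_sumset (Suc h) A)
           \<ge> card (hfold_sumset h A) + card ((\<lambda>n. n mod d) ` hfold_sumset (Suc h) A)"
proof -
  let ?X = "hfold_sumset h A" and ?Y = "hfold_sumset (Suc h) A" and ?m = "\<lambda>n. n mod d"
  let ?Z = "(\<lambda>x. x + d) ` ?X"
  have sub: "?Z \<subseteq> ?Y" using assms by (auto simp: hfold_sumset_Suc)
  have fin: "finite ?Y" "finite ?Z" using assms by auto
  have "?m y \<in> ?m ` (?Y - ?Z)" if y: "y \<in> ?Y" for y
  proof -
    let ?C = "{u \<in> ?Y. ?m u = ?m y}"
    have fC: "finite ?C" "?C \<noteq> {}" using fin(1) y by auto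
    define u where "u = Min ?C"
    have u: "u \<in> ?C" using Min_in[OF fC] by (simp add: u_def)
    have "u \<notin> ?Z"
    proof
      assume "u \<in> ?Z"
      then obtain x where x: "x \<in> ?X" "u = x + d" by auto
      then have "x \<in> ?C" using u hfold_sumset_Suc_subset[OF assms(2)] by auto
      then have "u \<le> x" using fC by (simp add: u_def)
      with x assms show False by simp
    qed
    with u show ?thesis by (auto simp: image_iff intro!: bexI[of _ u])
  qed
  then have "?m ` ?Y = ?m ` (?Y - ?Z)" by auto
  then have "card (?m ` ?Y) \<le> card (?Y - ?Z)" using fin by (simp add: card_image_le)
  also have "\<dots> = card ?Y - card ?Z" using sub fin by (simp add: card_Diff_subset)
  also have "card ?Z = card ?X" by (rule card_image) auto
  finally have "card (?m ` ?Y) \<le> card ?Y - card ?X" .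
  moreover have "card ?X \<le> card ?Y"
    using fin hfold_sumset_Suc_subset[OF assms(2)] by (simp add: card_mono)
  ultimately show ?thesis by simp
qed

text \<open>The integers whose translation modulo \<open>d\<close> keeps \<open>T\<close> inside
  itself form a subgroup containing \<open>d\<close> and \<open>B\<close>. Its least positive
  element divides all its members, hence \<open>Gcd B = 1\<close>; so translation by 1 is allowed
  and \<open>T\<close> is everything.\<close>

lemma mod_translation_closed_eq_atLeastLessThan:
  fixes d :: int
  assumes T: "T \<subseteq> {0..<d}" "T \<noteq> {}" and "d > 0" "Gcd B = 1"
    and closed: "\<And>t b. t \<in> T \<Longrightarrow> b \<in> B \<Longrightarrow> (t + b) mod d \<in> T"
  shows "T = {0..<d}"
proof -
  define P where "P = {p. \<forall>t\<in>T. (t + p) mod d \<in> T}"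
  have Tm: "t mod d = t" if "t \<in> T" for t
    using T(1) that by auto
  have P0: "0 \<in> P" and Pd: "d \<in> P" and BP: "B \<subseteq> P"
    using Tm closed by (auto simp: P_def)
  have Padd: "p + q \<in> P" if "p \<in> P" "q \<in> P" for p q
  proof -
    have "(t + (p + q)) mod d \<in> T" if "t \<in> T" for t
    proof -
      have "((t + p) mod d + q) mod d \<in> T" using \<open>p \<in> P\<close> \<open>q \<in> P\<close> that by (simp add: P_def)
      then show ?thesis by (simp add: mod_add_left_eq add.assoc)
    qed
    then show ?thesis by (simp add: P_def)
  qed
  have Pmult: "int n * p \<in> P" if "p \<in> P" for n p
    by (induction n) (use P0 Padd that in \<open>auto simp: algebra_simps\<close>)
  have Pmod: "p + d * c \<in> P \<longleftrightarrow> p \<in> P" for p c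
    by (simp add: P_def add.assoc[symmetric])
  \<comment> \<open>Modulo \<open>d\<close>, \<open>- p\<close> equals \<open>(d - 1) * p\<close>,
    so closure under addition already gives inverses.\<close>
  have Pneg: "- p \<in> P" if "p \<in> P" for p
  proof -
    have "int (nat (d - 1)) * p \<in> P" using that by (rule Pmult)
    also have "int (nat (d - 1)) * p = - p + d * p" using \<open>d > 0\<close> by (simp add: algebra_simps)
    finally show ?thesis by (simp only: Pmod)
  qed
  have Pimult: "c * p \<in> P" if "p \<in> P" for c p
    using Pmult[OF that, of "nat c"] Pmult[OF Pneg[OF that], of "nat (- c)"]
    by (cases "c \<ge> 0") auto
  define n where "n = (LEAST n. n > 0 \<and> int n \<in> P)"
  have n: "n > 0 \<and> int n \<in> P"
    unfolding n_def by (rule LeastI[of _ "nat d"]) (use Pd \<open>d > 0\<close> in auto)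
  have dvd: "int n dvd p" if "p \<in> P" for p
  proof (rule ccontr)
    assume "\<not> int n dvd p"
    then have pos: "p mod int n > 0" using n
      by (metis mod_0_imp_dvd of_nat_0_less_iff order_le_less pos_mod_sign)
    have "p + (- (p div int n)) * int n \<in> P" using Padd Pimult n that by blast
    then have "p mod int n \<in> P" by (simp add: minus_div_mult_eq_mod[symmetric])
    with pos have "nat (p mod int n) > 0 \<and> int (nat (p mod int n)) \<in> P" by simp
    then have "n \<le> nat (p mod int n)"
      unfolding n_def[symmetric] by (subst n_def) (rule Least_le)
    moreover have "p mod int n < int n" using n by simp
    ultimately show False using pos by linarith
  qed
  then have "int n dvd Gcd B" using BP by (auto intro: Gcd_greatest)
  then have "1 \<in> P" using assms(4) n by simp
  show ?thesis
  proof
    show "{0..<d} \<subseteq> T"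
    proof
      fix r assume r: "r \<in> {0..<d}"
      obtain t where t: "t \<in> T" using T(2) by auto
      have "r - t \<in> P" using Pimult[OF \<open>1 \<in> P\<close>, of "r - t"] by simp
      then have "(t + (r - t)) mod d \<in> T" using t unfolding P_def by blast
      then show "r \<in> T" using r by simp
    qed
  qed (rule T)
qed

section \<open>Residues modulo the largest element\<close>

text \<open>If $T = S + B$ is $S$ with one further residue $t$, then for every $b \in B$ with $b \not\equiv 0$
  some $s \in S$ has $s + b = t$; hence $t + c = (s + c) + b$ with $b \not\equiv c$ stays in $T$, so that
  $T$ is closed under translation by $B$.\<close>
lemma card_mod_sumset_ge:
  fixes d :: int
  assumes S: "S \<subseteq> {0..<d}" "S \<noteq> {}" and "d > 0" and B: "Gcd B = 1" "0 \<in> B"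
    and three: "b\<^sub>1 \<in> B" "b\<^sub>2 \<in> B" "b\<^sub>1 mod d \<noteq> 0" "b\<^sub>2 mod d \<noteq> 0" "b\<^sub>1 mod d \<noteq> b\<^sub>2 mod d"
    and T: "T = {(s + b) mod d |s b. s \<in> S \<and> b \<in> B}"
  shows "T = {0..<d} \<or> card T \<ge> card S + 2"
proof (rule ccontr)
  assume "\<not> ?thesis"
  then have nfull: "T \<noteq> {0..<d}" and small: "card T < card S + 2" by auto
  have Td: "T \<subseteq> {0..<d}" using T \<open>d > 0\<close> by auto
  have Smod: "s mod d = s" if "s \<in> S" for s using S(1) that by auto
  have Tmod: "s mod d = s" if "s \<in> T" for s using Td that by auto
  have ST: "S \<subseteq> T"
  proof
    fix s assume "s \<in> S"
    then have "s = (s + 0) mod d" using Smod by simp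
    with \<open>s \<in> S\<close> B(2) show "s \<in> T" unfolding T by blast
  qed
  have fT: "finite T" using Td finite_subset by blast
  then have fS: "finite S" using ST finite_subset by blast
  have step: "(s + b) mod d \<in> T" if "s \<in> S" "b \<in> B" for s b
    using that T by blast
  have cancel: "s = s'" if "(s + b) mod d = (s' + b) mod d" "s mod d = s" "s' mod d = s'" for s s' b
    using that by (metis add_diff_cancel_right' mod_diff_left_eq)
  have nclosed: "\<exists>t\<in>T. \<exists>b\<in>B. (t + b) mod d \<notin> T"
    using mod_translation_closed_eq_atLeastLessThan[OF Td _ \<open>d > 0\<close> B(1)] nfull ST S(2) by blast
  then have "S \<noteq> T" using step by blast
  then have "card S < card T" using ST fT by (simp add: psubset_card_mono psubsetI)
  then have "card (T - S) = 1" using small ST fS by (simp add: card_Diff_subset)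
  then obtain t where "T - S = {t}" by (meson card_1_singletonE)
  then have t: "T = insert t S" "t \<notin> S" using ST by auto
  \<comment> \<open>If \<open>b\<close> never led from \<open>S\<close> to \<open>t\<close>,
    translation by \<open>b\<close> would permute \<open>S\<close>. Writing
    \<open>t = s + c\<close>, the element \<open>t + b = (s + b) + c\<close> lies in
    \<open>T\<close>, but by injectivity not in \<open>S\<close>; so it is \<open>t\<close> itself,
    which forces \<open>b\<close> to be 0 modulo \<open>d\<close>.\<close>
  have reach: "\<exists>s\<in>S. t = (s + b) mod d" if b: "b \<in> B" "b mod d \<noteq> 0" for b
  proof (rule ccontr)
    assume "\<not> ?thesis"
    then have "(\<lambda>s. (s + b) mod d) ` S \<subseteq> S" using step[OF _ b(1)] t by auto
    moreover have "inj_on (\<lambda>s. (s + b) mod d) S"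
      using cancel Smod by (metis (no_types, lifting) inj_onI)
    ultimately have img: "(\<lambda>s. (s + b) mod d) ` S = S"
      using endo_inj_surj[OF fS] by blast
    obtain s c where sc: "t = (s + c) mod d" "s \<in> S" "c \<in> B" using t(1) T by blast
    have "((s + b) mod d + c) mod d \<in> T" using img sc by (intro step) auto
    moreover have "((s + b) mod d + c) mod d = (t + b) mod d"
      unfolding sc(1) by (simp add: mod_simps algebra_simps)
    ultimately have "(t + b) mod d \<in> T" by simp
    moreover have "(t + b) mod d \<notin> S"
    proof
      assume "(t + b) mod d \<in> S"
      then obtain s' where "s' \<in> S" "(t + b) mod d = (s' + b) mod d" using img by blast
      then have "t = s'" using cancel Smod Tmod t(1) by blast
      with \<open>s' \<in> S\<close> t show False by simp
    qed
    ultimately have "(t + b) mod d = t" using t(1) by simp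
    then have "(b + t) mod d = (0 + t) mod d" using Tmod t(1) by (simp add: add.commute)
    then have "b mod d = 0"
      by (metis add_diff_cancel_right' mod_diff_left_eq mod_0 diff_self)
    with b show False by simp
  qed
  obtain u c where u: "u \<in> T" "c \<in> B" "(u + c) mod d \<notin> T" using nclosed by blast
  have "u = t" using u step t(1) by blast
  have c0: "c mod d \<noteq> 0"
  proof
    assume "c mod d = 0"
    then have "(u + c) mod d = u" using Tmod[OF u(1)] by (metis add.right_neutral mod_add_right_eq)
    with u show False by simp
  qed
  obtain b where b: "b \<in> B" "b mod d \<noteq> 0" "b mod d \<noteq> c mod d"
    using three by metis
  obtain s where s: "s \<in> S" "t = (s + b) mod d" using reach[OF b(1,2)] by blast
  have "(s + c) mod d \<in> T" using step s u by blast
  moreover have "(s + c) mod d \<notin> S"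
  proof
    assume "(s + c) mod d \<in> S"
    then have "((s + c) mod d + b) mod d \<in> T" using step b by blast
    moreover have "((s + c) mod d + b) mod d = (u + c) mod d"
      unfolding \<open>u = t\<close> s(2) by (simp add: mod_simps algebra_simps)
    ultimately show False using u by simp
  qed
  ultimately have "(s + c) mod d = (s + b) mod d" using t(1) s(2) by simp
  then have "c mod d = b mod d"
    by (metis add_diff_cancel_left' mod_diff_left_eq)
  with b show False by simp
qed

text \<open>Only \<open>d\<close> collides, with 0. So \<open>A\<close> has
  \<open>card A - 1\<close> residues, the starting value of the residue count.\<close>

lemma mod_image_eq_Diff:
  assumes "A \<subseteq> {0..d}" "0 \<in> A" "d > (0::int)"
  shows "(\<lambda>n. n mod d) ` A = A - {d}"
proof -
  have less: "a mod d = a" "a \<noteq> d" if "a \<in> A - {d}" for a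
    using assms(1) that by (auto simp: le_less)
  have "(\<lambda>n. n mod d) ` (A - {d}) = A - {d}"
    using image_cong[of "A - {d}" "A - {d}" "\<lambda>n. n mod d" "\<lambda>n. n", OF refl less(1)]
    by (simp only: image_ident)
  moreover have "(\<lambda>n. n mod d) ` A \<subseteq> insert 0 ((\<lambda>n. n mod d) ` (A - {d}))"
    by auto
  moreover have "0 \<in> A - {d}" using assms by simp
  moreover have "(\<lambda>n. n mod d) ` (A - {d}) \<subseteq> (\<lambda>n. n mod d) ` A" by (rule image_mono) simp
  ultimately show ?thesis by (simp only: insert_absorb subset_antisym)
qed

lemma mod_image_hfold_sumset_Suc:
  "(\<lambda>n. n mod d) ` hfold_sumset (Suc h) A
     = {(s + a) mod d |s a. s \<in> (\<lambda>n. n mod d) ` hfold_sumset h A \<and> a \<in> A}"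
proof -
  have "(s mod d + a) mod d = (s + a) mod d" for s a by (rule mod_add_left_eq)
  then show ?thesis unfolding hfold_sumset_Suc by (auto simp: image_iff) metis+
qed

text \<open>Pigeonhole: \<open>B = A - {d}\<close> and \<open>r - B\<close> each occupy
  \<open>card A - 1\<close> residues, together more than \<open>d\<close>, so they meet and
  \<open>r\<close> is a sum of two elements modulo \<open>d\<close>.\<close>

lemma mod_hfold_sumset_2_eq_atLeastLessThan:
  assumes A: "A \<subseteq> {0..d}" "0 \<in> A" "d \<in> A" and d: "0 < d" "d < 2 * int (card A) - 2"
  shows "(\<lambda>n. n mod d) ` hfold_sumset 2 A = {0..<d}"
proof
  show "{0..<d} \<subseteq> (\<lambda>n. n mod d) ` hfold_sumset 2 A"
  proof
    fix r assume r: "r \<in> {0..<d}"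
    let ?B = "A - {d}" and ?f = "\<lambda>b. (r - b) mod d"
    have B: "?B \<subseteq> {0..<d}" using A by force
    have fB: "finite ?B" using B finite_subset by blast
    have "inj_on ?f ?B"
    proof (rule inj_onI)
      fix x y assume xy: "x \<in> ?B" "y \<in> ?B" "?f x = ?f y"
      then have "(r - (r - x)) mod d = (r - (r - y)) mod d" by (metis mod_diff_right_eq)
      with xy(1,2) B show "x = y" by (metis diff_diff_eq2 add_diff_cancel_left' atLeastLessThan_iff mod_pos_pos_trivial subsetD)
    qed
    then have card: "card (?f ` ?B) = card A - 1" using A fB by (simp add: card_image)
    have "?f ` ?B \<inter> ?B \<noteq> {}"
    proof
      assume disj: "?f ` ?B \<inter> ?B = {}"
      have "card (?f ` ?B \<union> ?B) \<le> card {0..<d}"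
        using B d by (intro card_mono) auto
      then have "card A - 1 + (card A - 1) \<le> nat d"
        using card_Un_disjoint[OF _ fB disj] fB card A by simp
      with d show False by linarith
    qed
    then obtain b where b: "b \<in> A" "(r - b) mod d \<in> A" by auto
    have "((r - b) mod d + b) mod d = r" using r by (simp add: mod_simps)
    moreover have "(r - b) mod d + b \<in> hfold_sumset 2 A"
      using b by (auto simp: hfold_sumset_2)
    ultimately show "r \<in> (\<lambda>n. n mod d) ` hfold_sumset 2 A"
      by (metis image_eqI)
  qed
qed (use d in auto)

text \<open>Four elements leave two strictly between 0 and \<open>d\<close>; these are the two
  distinct nonzero residues that \<open>card_mod_sumset_ge\<close> requires for a gain of two at
  each step.\<close>

lemma card_mod_hfold_sumset_ge:
  assumes A: "normalized A d" and k: "card A \<ge> 4"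
  shows "(\<lambda>n. n mod d) ` hfold_sumset (Suc h) A = {0..<d}
           \<or> card ((\<lambda>n. n mod d) ` hfold_sumset (Suc h) A) \<ge> card A - 1 + 2 * h"
proof (induction h)
  note A' = normalizedD[OF A]
  case 0
  show ?case using A' mod_image_eq_Diff[of A d] by simp
next
  note A' = normalizedD[OF A]
  case (Suc h)
  let ?R = "\<lambda>h. (\<lambda>n. n mod d) ` hfold_sumset h A"
  have sub: "?R (Suc h) \<subseteq> ?R (Suc (Suc h))"
    by (rule image_mono, rule hfold_sumset_Suc_subset, rule A')
  have sub': "?R h \<subseteq> {0..<d}" for h using A' by auto
  have "card (A - {0, d}) \<ge> 2"
    using k A' by (simp add: card_Diff_subset)
  then obtain b c where bc: "b \<in> A - {0, d}" "c \<in> A - {0, d}" "b \<noteq> c"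
    using obtain_subset_with_card_n[of 2 "A - {0, d}"] by (metis card_2_iff insert_subset)
  then have "b \<in> {0..<d}" "c \<in> {0..<d}" using A'(2) by (auto simp: le_less)
  then have mods: "b mod d = b" "c mod d = c" by simp_all
  have ne: "?R (Suc h) \<noteq> {}"
    using mult_mem_hfold_sumset[OF A'(4)] by blast
  have "?R (Suc (Suc h)) = {0..<d} \<or> card (?R (Suc (Suc h))) \<ge> card (?R (Suc h)) + 2"
    by (rule card_mod_sumset_ge[of _ d A b c, OF sub' ne A'(6,5,3)])
       (use bc mods mod_image_hfold_sumset_Suc in auto)
  then show ?case using Suc sub sub'[of "Suc (Suc h)"] by auto
qed

lemma card_hfold_sumset_2_ge:
  assumes "normalized A d"
  shows "card (hfold_sumset 2 A) \<ge> card A + card ((\<lambda>n. n mod d) ` hfold_sumset 2 A)"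
  using card_hfold_sumset_Suc_ge[of A d "Suc 0"] normalizedD[OF assms]
  by (simp add: numeral_2_eq_2)

text \<open>This is the dense half of Freiman's bound min(k + d, 3k - 3): all \<open>d\<close>
  residues occur in the double sumset.\<close>

lemma card_hfold_sumset_2_ge_dense:
  assumes A: "normalized A d" and "d < 2 * int (card A) - 2"
  shows "int (card (hfold_sumset 2 A)) \<ge> int (card A) + d"
  using card_hfold_sumset_2_ge[OF A] mod_hfold_sumset_2_eq_atLeastLessThan[of A d]
    normalizedD[OF A] assms(2) by simp

text \<open>From the third summand on, the number of residues is at least k - 1 + 4 = k + 3, unless
  all \<open>d >= k + 3\<close> of them occur.\<close>

lemma card_hfold_sumset_Suc_ge_add:
  assumes A: "normalized A d" and k: "card A \<ge> 5" and d: "d \<ge> int (card A) + 3" and h: "h \<ge> 2"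
  shows "card (hfold_sumset (Suc h) A) \<ge> card (hfold_sumset h A) + card A + 3"
proof -
  have "card ((\<lambda>n. n mod d) ` hfold_sumset (Suc h) A) \<ge> card A + 3"
    using card_mod_hfold_sumset_ge[OF A, of h] k d h by auto
  then show ?thesis
    using card_hfold_sumset_Suc_ge[of A d h] normalizedD[OF A] by simp
qed

section \<open>Doubling: removing the largest element\<close>

text \<open>Besides the old sums, \<open>2 * d\<close> is new by size, and so is each
  \<open>d + a\<close> that is not a sum of two smaller elements.\<close>

lemma card_hfold_sumset_2_ge_remove_Max:
  assumes A: "finite A" "A \<subseteq> {0..d}" "d \<in> A"
  shows "card (hfold_sumset 2 A) \<ge> card (hfold_sumset 2 (A - {d}))
           + card {a \<in> A - {d}. d + a \<notin> hfold_sumset 2 (A - {d})} + 1"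
proof -
  let ?X = "A - {d}"
  let ?N = "{a \<in> ?X. d + a \<notin> hfold_sumset 2 ?X}"
  have X: "finite ?X" using A by simp
  have lt: "x < d" if "x \<in> ?X" for x using that A by force
  have "(+) d ` ?N \<inter> hfold_sumset 2 ?X = {}" by auto
  moreover have "2 * d \<notin> hfold_sumset 2 ?X \<union> (+) d ` ?N"
  proof -
    have "n < 2 * d" if "n \<in> hfold_sumset 2 ?X" for n
      using that lt by (auto simp: hfold_sumset_2) (metis add_strict_mono mult_2)
    then show ?thesis using lt by force
  qed
  moreover have "card ((+) d ` ?N) = card ?N" by (simp add: card_image)
  ultimately have "card (insert (2 * d) (hfold_sumset 2 ?X \<union> (+) d ` ?N))
      = card (hfold_sumset 2 ?X) + card ?N + 1"
    using X by (simp add: card_Un_disjoint inf_commute)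
  moreover have "insert (2 * d) (hfold_sumset 2 ?X \<union> (+) d ` ?N) \<subseteq> hfold_sumset 2 A"
    using A by (auto simp: hfold_sumset_2 intro: exI[of _ d])
  then have "card (insert (2 * d) (hfold_sumset 2 ?X \<union> (+) d ` ?N)) \<le> card (hfold_sumset 2 A)"
    by (rule card_mono[rotated]) (use A in simp)
  ultimately show ?thesis by linarith
qed

lemma remove_Max_facts:
  assumes A: "normalized A d" and k: "card A \<ge> 3"
  defines "X \<equiv> A - {d}"
  shows "finite X" "card X = card A - 1" "0 \<in> X" "Max X \<in> X" "X \<subseteq> {0..Max X}"
    "0 < Max X" "Max X < d" "Gcd X = 1 \<Longrightarrow> normalized X (Max X)" "int (card X) \<le> Max X + 1"
proof -
  note A' = normalizedD[OF A]
  show fin: "finite X" and card: "card X = card A - 1" and zero: "0 \<in> X"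
    using A' by (auto simp: X_def)
  show Max: "Max X \<in> X" using fin zero by (auto intro: Max_in)
  show sub: "X \<subseteq> {0..Max X}"
  proof
    fix x assume "x \<in> X"
    moreover from this have "0 \<le> x" using A'(2) by (auto simp: X_def)
    ultimately show "x \<in> {0..Max X}" using Max_ge[OF fin] by simp
  qed
  have "card X \<le> card {0..Max X}" by (intro card_mono sub) auto
  then show le: "int (card X) \<le> Max X + 1" using zero sub by auto
  show "0 < Max X" using le card k by linarith
  show "Max X < d" using Max A' by (force simp: X_def)
  show "Gcd X = 1 \<Longrightarrow> normalized X (Max X)"
    using sub zero Max by (simp add: normalized_def)
qed

text \<open>The gcd of \<open>X = A - {d}\<close> divides every element of 2X but not
  \<open>d\<close>, so all k - 1 sums \<open>d + a\<close> are new, as is \<open>2 * d\<close>. With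
  |2X| >= (k - 1) + (k - 2) the total is 3k - 3.\<close>

lemma card_hfold_sumset_2_ge_of_Gcd_remove_Max:
  assumes A: "normalized A d" and k: "card A \<ge> 3" and g: "Gcd (A - {d}) \<noteq> 1"
  shows "card (hfold_sumset 2 A) \<ge> 3 * card A - 3"
proof -
  note A' = normalizedD[OF A]
  let ?X = "A - {d}"
  note X = remove_Max_facts[OF A k]
  have "\<not> Gcd ?X dvd d"
  proof
    assume "Gcd ?X dvd d"
    then have "Gcd ?X dvd Gcd A" by (intro Gcd_greatest) (metis Diff_iff Gcd_dvd singletonD)
    then show False using g A' by (metis Gcd_int_greater_eq_0 zdvd1_eq abs_of_nonneg)
  qed
  moreover have "Gcd ?X dvd s" if "s \<in> hfold_sumset 2 ?X" for s
    using that by (auto simp: hfold_sumset_2 simp del: Gcd_insert)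
  ultimately have "{a \<in> ?X. d + a \<notin> hfold_sumset 2 ?X} = ?X"
    by (metis (mono_tags, lifting) Gcd_dvd dvd_add_left_iff Collect_mem_eq Collect_cong)
  then have "card (hfold_sumset 2 A) \<ge> card (hfold_sumset 2 ?X) + card ?X + 1"
    using card_hfold_sumset_2_ge_remove_Max[OF A'(1,2,4)] by simp
  moreover have "card (hfold_sumset 2 ?X) \<ge> card ?X + card ((\<lambda>n. n mod Max ?X) ` hfold_sumset 2 ?X)"
    using card_hfold_sumset_Suc_ge[of ?X "Max ?X" "Suc 0"] X by (simp add: numeral_2_eq_2)
  moreover have "card ((\<lambda>n. n mod Max ?X) ` ?X) \<le> card ((\<lambda>n. n mod Max ?X) ` hfold_sumset 2 ?X)"
    using X hfold_sumset_mono_fold[of ?X "Suc 0" 2] by (intro card_mono image_mono) auto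
  moreover have "card ((\<lambda>n. n mod Max ?X) ` ?X) = card ?X - 1"
    using mod_image_eq_Diff[of ?X "Max ?X"] X by simp
  ultimately show ?thesis using X(2) k by linarith
qed

text \<open>Let e be the maximum of \<open>X = A - {d}\<close>. The dense bound gives |2X| >= (k -
  1) + e, and \<open>d + a\<close> exceeds 2e, hence is new, as soon as a > 2e - d. The first
  estimate follows from the second, as at most max(0, 2e - d + 1) elements of X are not above 2e -
  d.\<close>

lemma card_hfold_sumset_2_ge_remove_Max_dense:
  assumes A: "normalized A d" and k: "card A \<ge> 3" and g: "Gcd (A - {d}) = 1"
    and m: "Max (A - {d}) < 2 * int (card A) - 4"
  shows "int (card (hfold_sumset 2 A))
           \<ge> 2 * int (card A) - 1 + Max (A - {d}) - max 0 (2 * Max (A - {d}) - d + 1)"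
    and "int (card (hfold_sumset 2 A)) \<ge> int (card A) + Max (A - {d})
           + int (card {a \<in> A - {d}. a > 2 * Max (A - {d}) - d})"
proof -
  note A' = normalizedD[OF A]
  define X where "X = A - {d}"
  define e where "e = Max X"
  note X = remove_Max_facts[OF A k, folded X_def, folded e_def]
  have "int (card (hfold_sumset 2 X)) \<ge> int (card X) + e"
    using card_hfold_sumset_2_ge_dense[of X e] X g m k unfolding X_def e_def by simp
  moreover have "card (hfold_sumset 2 A) \<ge> card (hfold_sumset 2 X)
      + card {a \<in> X. d + a \<notin> hfold_sumset 2 X} + 1"
    using card_hfold_sumset_2_ge_remove_Max[OF A'(1,2,4)] by (simp add: X_def)
  moreover have "card {a \<in> X. a > 2 * e - d} \<le> card {a \<in> X. d + a \<notin> hfold_sumset 2 X}"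
  proof -
    have "n \<le> 2 * e" if "n \<in> hfold_sumset 2 X" for n
      using hfold_sumset_subset_atLeastAtMost[OF X(5), of 2] that by auto
    then show ?thesis using X(1) by (intro card_mono) force+
  qed
  ultimately have *: "int (card (hfold_sumset 2 A))
      \<ge> int (card A) + e + int (card {a \<in> X. a > 2 * e - d})"
    using X(2) k by linarith
  then show "int (card (hfold_sumset 2 A)) \<ge> int (card A) + Max (A - {d})
      + int (card {a \<in> A - {d}. a > 2 * Max (A - {d}) - d})"
    by (simp add: X_def e_def)
  have "card X \<le> card ({a \<in> X. a > 2 * e - d} \<union> {0..2 * e - d})"
    using X(1,5) by (intro card_mono) auto
  also have "\<dots> \<le> card {a \<in> X. a > 2 * e - d} + card {0..2 * e - d}"
    by (rule card_Un_le)
  also have "int \<dots> = int (card {a \<in> X. a > 2 * e - d}) + max 0 (2 * e - d + 1)"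
    by simp
  finally show "int (card (hfold_sumset 2 A))
           \<ge> 2 * int (card A) - 1 + Max (A - {d}) - max 0 (2 * Max (A - {d}) - d + 1)"
    using * X(2) k unfolding X_def e_def by linarith
qed

section \<open>Evaluating double sumsets of small explicit sets\<close>

lemma set_sorted_list_5:
  fixes A :: "int set"
  assumes "finite A" "card A = 5"
  obtains x y z u v where "A = {x, y, z, u, v}" "x < y" "y < z" "z < u" "u < v"
proof -
  obtain xs where xs: "sorted xs" "distinct xs" "set xs = A" "length xs = 5"
    using finite_sorted_distinct_unique[OF assms(1)] assms(2) by (metis distinct_card)
  then have "sorted_wrt (<) xs" by (simp add: strict_sorted_iff)
  with xs(3,4) that show ?thesis
    by (auto simp: numeral_eq_Suc length_Suc_conv)
qed

lemma set_sorted_list_6: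
  fixes A :: "int set"
  assumes "finite A" "card A = 6"
  obtains x y z u v w where "A = {x, y, z, u, v, w}" "x < y" "y < z" "z < u" "u < v" "v < w"
proof -
  obtain xs where xs: "sorted xs" "distinct xs" "set xs = A" "length xs = 6"
    using finite_sorted_distinct_unique[OF assms(1)] assms(2) by (metis distinct_card)
  then have "sorted_wrt (<) xs" by (simp add: strict_sorted_iff)
  with xs(3,4) that show ?thesis
    by (auto simp: numeral_eq_Suc length_Suc_conv)
qed

text \<open>A list version of the double sumset, so that its cardinality can be computed by
  evaluation.\<close>

definition pair_sums :: "int list \<Rightarrow> int list" where
  "pair_sums xs = [x + y. x \<leftarrow> xs, y \<leftarrow> xs]"

lemma card_hfold_sumset_2_set: "card (hfold_sumset 2 (set xs)) = length (remdups (pair_sums xs))"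
proof -
  have "hfold_sumset 2 (set xs) = set (pair_sums xs)"
    by (auto simp: hfold_sumset_2 pair_sums_def)
  then show ?thesis by (simp add: length_remdups_card_conv)
qed

text \<open>The cases of the inductive step for 5, 6 and 7 elements that counting does not settle.\<close>
lemma pair_sums_5_check:
  "\<forall>e\<in>set [3..5]. \<forall>c\<in>set [2..e - 1]. \<forall>b\<in>set [1..c - 1]. \<forall>d\<in>set [8..2 * e].
     length (remdups (pair_sums [0, b, c, e, d])) \<ge> 12"
  by code_simp

lemma pair_sums_6_check:
  "\<forall>e\<in>set [5..7]. \<forall>f\<in>set [3..e - 1]. \<forall>c\<in>set [2..f - 1]. \<forall>b\<in>set [1..c - 1].
     \<forall>d\<in>set [10..2 * e]. length (remdups (pair_sums [0, b, c, f, e, d])) \<ge> 15"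
  by code_simp

lemma pair_sums_7_check: "length (remdups (pair_sums [0, 1, 2, 3, 4, 8, 12])) \<ge> 17"
  by code_simp

section \<open>Sets of large diameter\<close>

text \<open>Together with its mirror image, the second alternative leaves only sets of small diameter.\<close>
lemma card_hfold_sumset_2_ge_or_top:
  assumes A: "normalized A d" and k: "card A \<ge> 4"
    and IH: "\<And>X e. normalized X e \<Longrightarrow> card X = card A - 1 \<Longrightarrow> e \<ge> 2 * int (card X) - 2
               \<Longrightarrow> card (hfold_sumset 2 X) \<ge> 3 * card X - 3"
    and dense: "Gcd (A - {d}) = 1 \<Longrightarrow> Max (A - {d}) < 2 * int (card A) - 4
               \<Longrightarrow> card (hfold_sumset 2 A) \<ge> 3 * card A - 3"
  shows "card (hfold_sumset 2 A) \<ge> 3 * card A - 3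
           \<or> (\<forall>a\<in>A - {d, Max (A - {d})}. d + a \<in> hfold_sumset 2 (A - {d}))"
proof (rule ccontr)
  note A' = normalizedD[OF A]
  define X where "X = A - {d}"
  define e where "e = Max X"
  have k3: "card A \<ge> 3" using k by simp
  note X = remove_Max_facts[OF A k3, folded X_def, folded e_def]
  assume contra: "\<not> ?thesis"
  then have lt: "card (hfold_sumset 2 A) < 3 * card A - 3" by simp
  from contra obtain a where a: "a \<in> X" "a \<noteq> e" "d + a \<notin> hfold_sumset 2 X"
    by (auto simp: X_def e_def)
  have g: "Gcd X = 1"
    using card_hfold_sumset_2_ge_of_Gcd_remove_Max[OF A k3] contra by (auto simp: X_def)
  then have "e \<ge> 2 * int (card X) - 2"
    using dense contra X(2) k by (force simp: X_def[symmetric] e_def[symmetric])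
  then have "card (hfold_sumset 2 X) \<ge> 3 * card X - 3"
    using IH X(2) X(8)[OF g] by blast
  moreover have "card (hfold_sumset 2 A) \<ge> card (hfold_sumset 2 X)
      + card {a \<in> X. d + a \<notin> hfold_sumset 2 X} + 1"
    using card_hfold_sumset_2_ge_remove_Max[OF A'(1,2,4)] by (simp add: X_def)
  \<comment> \<open>The sum \<open>d + e\<close> is always new because it exceeds
    \<open>2 * e\<close>. With \<open>d + a\<close> and \<open>2 * d\<close> there are three new
    sums, exactly the growth of 3k - 3 per element.\<close>
  moreover have "d + e \<notin> hfold_sumset 2 X"
    using hfold_sumset_subset_atLeastAtMost[OF X(5), of 2] X(7) by auto
  then have "card {a, e} \<le> card {a \<in> X. d + a \<notin> hfold_sumset 2 X}"
    using a X(1,4) by (intro card_mono) auto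
  then have "card {a \<in> X. d + a \<notin> hfold_sumset 2 X} \<ge> 2" using a(2) by simp
  ultimately show False using lt X(2) k by linarith
qed

section \<open>Freiman's bound for four, five and six elements\<close>

lemma reflect_Diff_insert_0: "(\<lambda>a. d - a) ` A - {d} = (\<lambda>a. d - a) ` (A - {0::int})"
  by auto

lemma Max_reflect:
  fixes X :: "int set"
  assumes "finite X" "X \<noteq> {}"
  shows "Max ((\<lambda>a. d - a) ` X) = d - Min X"
proof (rule Max_eqI)
  show "d - Min X \<in> (\<lambda>a. d - a) ` X" using assms by (intro imageI Min_in)
qed (use assms in auto)

text \<open>The residue count suffices here: its value 2k + 1 equals 3k - 3 for k = 4.\<close>

lemma card_hfold_sumset_2_ge_4:
  assumes "normalized A d" "card A = 4" "d \<ge> 6"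
  shows "card (hfold_sumset 2 A) \<ge> 9"
  using card_mod_hfold_sumset_ge[of A d 1] card_hfold_sumset_2_ge[of A d] assms
  by (auto simp: numeral_2_eq_2)

lemma card_hfold_sumset_2_ge_or_top_5:
  assumes A: "normalized A d" and k: "card A = 5" and d: "d \<ge> 8"
  shows "card (hfold_sumset 2 A) \<ge> 12
           \<or> (\<forall>a\<in>A - {d, Max (A - {d})}. d + a \<in> hfold_sumset 2 (A - {d}))"
proof -
  note A' = normalizedD[OF A]
  have "card (hfold_sumset 2 A) \<ge> 12" if g: "Gcd (A - {d}) = 1" and m: "Max (A - {d}) < 6"
  \<comment> \<open>Let e be the second largest element. For d > 2e every \<open>d + a\<close> is
    new and counting yields 9 + e >= 12. For d <= 2e only finitely many sets remain, with 3 <= e <=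
    5 and 8 <= d <= 2e, and these are evaluated.\<close>
  proof (cases "d \<le> 2 * Max (A - {d})")
    case True
    obtain z b c e v where s: "A = {z, b, c, e, v}" "z < b" "b < c" "c < e" "e < v"
      using set_sorted_list_5[OF A'(1) k] by blast
    have zv: "z = 0" "v = d" using A'(2,3,4) s by auto
    then have "A - {d} = {0, b, c, e}" using s by auto
    then have "Max (A - {d}) = e" using s zv by simp
    then have "d \<le> 2 * e" "e < 6" using True m by simp_all
    then have "length (remdups (pair_sums [0, b, c, e, d])) \<ge> 12"
      using d s(2-) zv by (intro pair_sums_5_check[rule_format], unfold set_upto atLeastAtMost_iff) linarith+
    then show ?thesis using card_hfold_sumset_2_set[of "[0, b, c, e, d]"] s zv by simp
  next
    case False
    have "Max (A - {d}) \<ge> 3" using remove_Max_facts(2,9)[OF A] k by simp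
    with False show ?thesis
      using card_hfold_sumset_2_ge_remove_Max_dense(1)[OF A _ g] k m by simp
  qed
  then show ?thesis
    using card_hfold_sumset_2_ge_or_top[OF A] card_hfold_sumset_2_ge_4 k by simp
qed

text \<open>This is the mirror image of the second alternative in
  \<open>card_hfold_sumset_2_ge_or_top\<close>: elements just above the bottom become sums of two
  nonzero elements of \<open>A\<close>.\<close>

lemma bottom_of_top_reflect:
  assumes A: "finite A" "card A \<ge> 2"
    and top: "\<forall>a\<in>(\<lambda>a. d - a) ` A - {d, Max ((\<lambda>a. d - a) ` A - {d})}.
                d + a \<in> hfold_sumset 2 ((\<lambda>a. d - a) ` A - {d})"
    and a: "a \<in> A - {0, Min (A - {0})}"
  shows "a \<in> hfold_sumset 2 (A - {0::int})"
proof -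
  have "d - a \<in> (\<lambda>a. d - a) ` A - {d, Max ((\<lambda>a. d - a) ` A - {d})}"
  proof -
    have "Max ((\<lambda>a. d - a) ` (A - {0})) = d - Min (A - {0})"
      using a A by (intro Max_reflect) auto
    then show ?thesis using a by (auto simp: reflect_Diff_insert_0)
  qed
  then have "d + (d - a) \<in> hfold_sumset 2 ((\<lambda>a. d - a) ` (A - {0}))"
    using bspec[OF top] unfolding reflect_Diff_insert_0 by blast
  then show ?thesis by (auto simp: hfold_sumset_reflect)
qed

lemma normalized_dvd:
  assumes "normalized A d" "\<And>a. a \<in> A \<Longrightarrow> m dvd a"
  shows "\<bar>m\<bar> = 1"
proof -
  have "m dvd Gcd A" using assms(2) by (rule Gcd_greatest)
  then show ?thesis using normalizedD(5)[OF assms(1)] by simp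
qed

text \<open>In a counterexample the relations at the top hold for \<open>A\<close> and for its
  mirror image. Ordering leaves few ways to write each element as such a sum, and together they
  force {0, a, 2a, 3a, 4a}; then gcd 1 gives d = 4.\<close>

lemma card_hfold_sumset_2_ge_5:
  assumes A: "normalized A d" and k: "card A = 5" and d: "d \<ge> 8"
  shows "card (hfold_sumset 2 A) \<ge> 12"
proof (rule ccontr)
  note A' = normalizedD[OF A]
  assume contra: "\<not> ?thesis"
  then have top: "\<forall>a\<in>A - {d, Max (A - {d})}. d + a \<in> hfold_sumset 2 (A - {d})"
    using card_hfold_sumset_2_ge_or_top_5[OF A k d] by blast
  have "card (hfold_sumset 2 ((\<lambda>a. d - a) ` A)) \<ge> 12
    \<or> (\<forall>a\<in>(\<lambda>a. d - a) ` A - {d, Max ((\<lambda>a. d - a) ` A - {d})}.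
          d + a \<in> hfold_sumset 2 ((\<lambda>a. d - a) ` A - {d}))"
    by (rule card_hfold_sumset_2_ge_or_top_5[OF normalized_reflect[OF A]])
       (use k d in \<open>simp_all add: card_reflect\<close>)
  then have top': "\<forall>a\<in>(\<lambda>a. d - a) ` A - {d, Max ((\<lambda>a. d - a) ` A - {d})}.
      d + a \<in> hfold_sumset 2 ((\<lambda>a. d - a) ` A - {d})"
    using contra unfolding card_hfold_sumset_reflect by blast
  have bottom: "a \<in> hfold_sumset 2 (A - {0})" if "a \<in> A - {0, Min (A - {0})}" for a
    using bottom_of_top_reflect[OF A'(1) _ top' that] k by simp
  obtain z a b c v where s: "A = {z, a, b, c, v}" "z < a" "a < b" "b < c" "c < v"
    using set_sorted_list_5[OF A'(1) k] by blast
  have zv: "z = 0" "v = d" using A'(2,3,4) s by auto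
  have X: "A - {d} = {0, a, b, c}" "A - {0} = {a, b, c, d}" using s zv by auto
  then have M: "Max (A - {d}) = c" "Min (A - {0}) = a" using s zv by simp_all
  have order: "0 < a" "a < b" "b < c" "c < d"
    using s zv by simp_all
  have "b \<in> hfold_sumset 2 {a, b, c, d}" using bottom[unfolded M] s zv X by simp
  then have 1: "b = 2 * a"
    unfolding hfold_sumset_2 using order by auto
  have "c \<in> hfold_sumset 2 {a, b, c, d}" using bottom[unfolded M] s zv X by simp
  then have 2: "c = a + b \<or> c = 2 * b"
    unfolding hfold_sumset_2 using order 1 by auto
  have "d + b \<in> hfold_sumset 2 {0, a, b, c}" using top[unfolded M] s zv X by simp
  then have 3: "d + b = 2 * c"
    unfolding hfold_sumset_2 using order by auto
  have "d + a \<in> hfold_sumset 2 {0, a, b, c}" using top[unfolded M] s zv X by simp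
  then have 4: "d + a = c + b \<or> d + a = 2 * b"
    unfolding hfold_sumset_2 using order 3 by auto
  have "b = 2 * a" "c = 3 * a" "d = 4 * a" using 1 2 3 4 order by auto
  moreover from this have "\<bar>a\<bar> = 1" using s zv by (intro normalized_dvd[OF A]) auto
  ultimately show False using d by auto
qed

lemma card_hfold_sumset_2_ge_or_top_6:
  assumes A: "normalized A d" and k: "card A = 6" and d: "d \<ge> 10"
  shows "card (hfold_sumset 2 A) \<ge> 15
           \<or> (\<forall>a\<in>A - {d, Max (A - {d})}. d + a \<in> hfold_sumset 2 (A - {d}))"
proof -
  note A' = normalizedD[OF A]
  have "card (hfold_sumset 2 A) \<ge> 15" if g: "Gcd (A - {d}) = 1" and m: "Max (A - {d}) < 8"
  proof (cases "d \<le> 2 * Max (A - {d})")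
    case True
    obtain z b c f e v where s: "A = {z, b, c, f, e, v}" "z < b" "b < c" "c < f" "f < e" "e < v"
      using set_sorted_list_6[OF A'(1) k] by blast
    have zv: "z = 0" "v = d" using A'(2,3,4) s by auto
    then have "A - {d} = {0, b, c, f, e}" using s by auto
    then have "Max (A - {d}) = e" using s zv by simp
    then have "d \<le> 2 * e" "e < 8" using True m by simp_all
    then have "length (remdups (pair_sums [0, b, c, f, e, d])) \<ge> 15"
      using d s(2-) zv by (intro pair_sums_6_check[rule_format], unfold set_upto atLeastAtMost_iff) linarith+
    then show ?thesis using card_hfold_sumset_2_set[of "[0, b, c, f, e, d]"] s zv by simp
  next
    case False
    have "Max (A - {d}) \<ge> 4" using remove_Max_facts(2,9)[OF A] k by simp
    with False show ?thesis
      using card_hfold_sumset_2_ge_remove_Max_dense(1)[OF A _ g] k m by simp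
  qed
  then show ?thesis
    using card_hfold_sumset_2_ge_or_top[OF A] card_hfold_sumset_2_ge_5 k by simp
qed

text \<open>The same relations leave, up to scaling, only {0, 1, 2, 3, 4, 5}, {0, 2, 4, 6, 7, 8},
  {0, 1, 2, 4, 6, 8} and {0, 1, 2, 4, 5, 6}; gcd 1 removes the scale, so d <= 8.\<close>

lemma card_hfold_sumset_2_ge_6:
  assumes A: "normalized A d" and k: "card A = 6" and d: "d \<ge> 10"
  shows "card (hfold_sumset 2 A) \<ge> 15"
proof (rule ccontr)
  note A' = normalizedD[OF A]
  assume contra: "\<not> ?thesis"
  then have top: "\<forall>a\<in>A - {d, Max (A - {d})}. d + a \<in> hfold_sumset 2 (A - {d})"
    using card_hfold_sumset_2_ge_or_top_6[OF A k d] by blast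
  have "card (hfold_sumset 2 ((\<lambda>a. d - a) ` A)) \<ge> 15
    \<or> (\<forall>a\<in>(\<lambda>a. d - a) ` A - {d, Max ((\<lambda>a. d - a) ` A - {d})}.
          d + a \<in> hfold_sumset 2 ((\<lambda>a. d - a) ` A - {d}))"
    by (rule card_hfold_sumset_2_ge_or_top_6[OF normalized_reflect[OF A]])
       (use k d in \<open>simp_all add: card_reflect\<close>)
  then have top': "\<forall>a\<in>(\<lambda>a. d - a) ` A - {d, Max ((\<lambda>a. d - a) ` A - {d})}.
      d + a \<in> hfold_sumset 2 ((\<lambda>a. d - a) ` A - {d})"
    using contra unfolding card_hfold_sumset_reflect by blast
  have bottom: "a \<in> hfold_sumset 2 (A - {0})" if "a \<in> A - {0, Min (A - {0})}" for a
    using bottom_of_top_reflect[OF A'(1) _ top' that] k by simp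
  obtain z a b c e v where s: "A = {z, a, b, c, e, v}" "z < a" "a < b" "b < c" "c < e" "e < v"
    using set_sorted_list_6[OF A'(1) k] by blast
  have zv: "z = 0" "v = d" using A'(2,3,4) s by auto
  have X: "A - {d} = {0, a, b, c, e}" "A - {0} = {a, b, c, e, d}" using s zv by auto
  then have M: "Max (A - {d}) = e" "Min (A - {0}) = a" using s zv by simp_all
  have order: "0 < a" "a < b" "b < c" "c < e" "e < d"
    using s zv by simp_all
  have "b \<in> hfold_sumset 2 {a, b, c, e, d}" using bottom[unfolded M] s zv X by simp
  then have b: "b = 2 * a"
    unfolding hfold_sumset_2 using order by auto
  have "c \<in> hfold_sumset 2 {a, b, c, e, d}" using bottom[unfolded M] s zv X by simp
  then have c: "c = a + b \<or> c = 2 * b"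
    unfolding hfold_sumset_2 using order b by auto
  have "d + c \<in> hfold_sumset 2 {0, a, b, c, e}" using top[unfolded M] s zv X by simp
  then have e: "d + c = 2 * e"
    unfolding hfold_sumset_2 using order by auto
  have "d + b \<in> hfold_sumset 2 {0, a, b, c, e}" using top[unfolded M] s zv X by simp
  then have d': "d + b = e + c \<or> d + b = 2 * c"
    unfolding hfold_sumset_2 using order e by auto
  consider "c = a + b" "d + b = e + c" | "c = a + b" "d + b = 2 * c"
    | "c = 2 * b" "d + b = e + c" | "c = 2 * b" "d + b = 2 * c"
    using c d' by blast
  then show False
  proof cases
    case 2
    \<comment> \<open>Here d = 2c - b = 4a, and d + c = 2e becomes 7a = 2e.\<close>
    then have "even (7 * a)" using b e by presburger
    then obtain t where "a = 2 * t" by auto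
    then have "a = t * 2" "b = t * 4" "c = t * 6" "e = t * 7" "d = t * 8" using b e 2 by auto
    moreover from this have "\<bar>t\<bar> = 1" using s zv by (intro normalized_dvd[OF A]) auto
    ultimately show False using d by auto
  next
    case 1
    then have "b = a * 2" "c = a * 3" "e = a * 4" "d = a * 5" using b e by auto
    moreover from this have "\<bar>a\<bar> = 1" using s zv by (intro normalized_dvd[OF A]) auto
    ultimately show False using d by auto
  next
    case 3
    then have "b = a * 2" "c = a * 4" "e = a * 6" "d = a * 8" using b e by auto
    moreover from this have "\<bar>a\<bar> = 1" using s zv by (intro normalized_dvd[OF A]) auto
    ultimately show False using d by auto
  next
    case 4
    then have "b = a * 2" "c = a * 4" "e = a * 5" "d = a * 6" using b e by auto
    moreover from this have "\<bar>a\<bar> = 1" using s zv by (intro normalized_dvd[OF A]) auto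
    ultimately show False using d by auto
  qed
qed

text \<open>The claim grows by only two per element, and \<open>2 * d\<close> and
  \<open>d + e\<close> are always new, with e the second largest element. Induction therefore works
  while e >= |X| + 3 for the remaining set X; otherwise X is dense and is counted directly.\<close>

lemma card_hfold_sumset_2_ge_twice_plus_3:
  assumes "normalized A d" "card A \<ge> 6" "d \<ge> int (card A) + 3"
  shows "card (hfold_sumset 2 A) \<ge> 2 * card A + 3"
  using assms
proof (induction "card A" arbitrary: A d rule: less_induct)
  case less
  note A = less.prems(1) and k = less.prems(2) and d = less.prems(3)
  note A' = normalizedD[OF A]
  have k3: "card A \<ge> 3" using k by simp
  consider "d < 2 * int (card A) - 2" | "card A = 6" "d \<ge> 10"
    | "card A \<ge> 7" "d \<ge> 2 * int (card A) - 2" using k by linarith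
  then show ?case
  proof cases
    case 1
    then show ?thesis using card_hfold_sumset_2_ge_dense[OF A] d by linarith
  next
    case 2
    then show ?thesis using card_hfold_sumset_2_ge_6[OF A] by simp
  next
    case 3
    define X where "X = A - {d}"
    define e where "e = Max X"
    note X = remove_Max_facts[OF A k3, folded X_def, folded e_def]
    show ?thesis
    proof (cases "Gcd X = 1")
      case False
      then show ?thesis
        using card_hfold_sumset_2_ge_of_Gcd_remove_Max[OF A k3] 3 by (simp add: X_def)
    next
      case g: True
      show ?thesis
      proof (cases "e \<ge> int (card A) + 2")
        case True
        have "card (hfold_sumset 2 X) \<ge> 2 * card X + 3"
          using less.hyps[OF _ X(8)[OF g]] X(2) 3 True by simp
        moreover have "card (hfold_sumset 2 A) \<ge> card (hfold_sumset 2 X)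
            + card {a \<in> X. d + a \<notin> hfold_sumset 2 X} + 1"
          using card_hfold_sumset_2_ge_remove_Max[OF A'(1,2,4)] by (simp add: X_def)
        moreover have "d + e \<notin> hfold_sumset 2 X"
          using hfold_sumset_subset_atLeastAtMost[OF X(5), of 2] X(7) by auto
        then have "card {e} \<le> card {a \<in> X. d + a \<notin> hfold_sumset 2 X}"
          using X(1,4) by (intro card_mono) auto
        ultimately show ?thesis using X(2) 3 by simp
      next
        case False
        have e: "e \<ge> int (card A) - 2" using X(2,9) 3 by simp
        have bounds: "int (card (hfold_sumset 2 A)) \<ge> 2 * int (card A) - 1 + e - max 0 (2 * e - d + 1)"
          "int (card (hfold_sumset 2 A)) \<ge> int (card A) + e + int (card {a \<in> X. a > 2 * e - d})"
          using card_hfold_sumset_2_ge_remove_Max_dense[OF A k3] g False 3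
          by (simp_all add: X_def e_def)
        show ?thesis
        \<comment> \<open>If the maximum is positive, the left side below is d - e - 1, which is at
          least (2k - 2) - (k + 1) - 1 = k - 4. This falls below 4 only for k = 7, d = 12, e =
          8.\<close>
        proof (cases "card A = 7 \<and> d = 12 \<and> e = 8")
          case False
          then have "e - max 0 (2 * e - d + 1) \<ge> 4"
            using 3 \<open>\<not> e \<ge> int (card A) + 2\<close> e by (auto simp: max_def)
          then show ?thesis using bounds(1) by linarith
        next
          case True
          show ?thesis
          \<comment> \<open>Here 2e - d = 4. Two elements above 4 already give 7 + 8 + 2 = 17; with
            only 8 above 4, the six elements of \<open>X\<close> must be 0, ..., 4 and 8.\<close>
          proof (cases "card {a \<in> X. a > 4} \<ge> 2")
            case True
            with \<open>card A = 7 \<and> d = 12 \<and> e = 8\<close> bounds(2) show ?thesis by simp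
          next
            case False
            have "{a \<in> X. a > 4} = {8}"
            proof (rule ccontr)
              assume "{a \<in> X. a > 4} \<noteq> {8}"
              then obtain a where "a \<in> X" "a > 4" "a \<noteq> 8" using X(4) True by auto
              then have "card {a, 8} \<le> card {a \<in> X. a > 4}"
                using X(1,4) True by (intro card_mono) auto
              with \<open>a \<noteq> 8\<close> False show False by simp
            qed
            then have "X \<subseteq> {0..4} \<union> {8}" using X(5) by force
            moreover have "card X = card ({0..4} \<union> {8::int})" using X(2) True by simp
            ultimately have "X = {0..4} \<union> {8}" by (intro card_subset_eq) auto
            moreover have "{0..4} = {0, 1, 2, 3, 4::int}" by auto
            ultimately have "A = set [0, 1, 2, 3, 4, 8, 12]"
              using X_def True A'(4) by (auto simp: insert_absorb)
            then have "card (hfold_sumset 2 A) \<ge> 17"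
              using card_hfold_sumset_2_set pair_sums_7_check by metis
            then show ?thesis using True by simp
          qed
        qed
      qed
    qed
  qed
qed

text \<open>Each summand after the second adds k + 3 to the starting value 2k + 2, or 2k + 3 when k
  >= 6.\<close>

lemma card_hfold_sumset_ge:
  assumes A: "normalized A d" and k: "card A \<ge> 5" and d: "d \<ge> int (card A) + 3" and h: "h \<ge> 2"
  shows "card (hfold_sumset h A) + 4 \<ge> h * card A + 3 * h"
    and "card A \<ge> 6 \<Longrightarrow> card (hfold_sumset h A) + 3 \<ge> h * card A + 3 * h"
proof -
  have step: "card (hfold_sumset h A) + 2 * (card A + 3) \<ge> h * (card A + 3) + card (hfold_sumset 2 A)"
    using h
  proof (induction h rule: dec_induct)
    case (step n)
    then show ?case using card_hfold_sumset_Suc_ge_add[OF A k d, of n] by simp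
  qed simp
  have "card (hfold_sumset 2 A) \<ge> 2 * card A + 2"
    using card_hfold_sumset_2_ge_5[OF A] card_hfold_sumset_2_ge_twice_plus_3[OF A] k d
    by (cases "card A = 5") auto
  with step show "card (hfold_sumset h A) + 4 \<ge> h * card A + 3 * h"
    by (simp add: algebra_simps)
  show "card (hfold_sumset h A) + 3 \<ge> h * card A + 3 * h" if "card A \<ge> 6"
    using step card_hfold_sumset_2_ge_twice_plus_3[OF A that d] by (simp add: algebra_simps)
qed

section \<open>Gaps of iterated sumsets\<close>

text \<open>The upper end of the sumset is treated by applying this to the reflected set.\<close>

definition low_gaps :: "nat \<Rightarrow> int \<Rightarrow> int set \<Rightarrow> int set" where
  "low_gaps h N A = {0..N} - hfold_sumset h A"

text \<open>Write n = qN + r. If r > 0, the residue r is represented in 2A by some m = pN + r with p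
  = 0 or p = 1, and n is m plus q - p copies of N. The lower bound on n gives q >= p; the upper one
  gives q <= h - 2, so h summands suffice.\<close>

lemma middle_mem_hfold_sumset:
  assumes A: "A \<subseteq> {0..N}" "0 \<in> A" "N \<in> A" and N: "0 < N" "N < 2 * int (card A) - 2"
    and n: "N \<le> n" "n \<le> (int h - 1) * N"
  shows "n \<in> hfold_sumset h A"
proof -
  define q r where "q = n div N" and "r = n mod N"
  have n_eq: "n = q * N + r" and r: "0 \<le> r" "r < N"
    using N by (simp_all add: q_def r_def)
  have "q \<ge> 1" using n N by (simp add: q_def pos_imp_zdiv_pos_iff int_one_le_iff_zero_less)
  have mult: "int i * N \<in> hfold_sumset i A" for i by (rule mult_mem_hfold_sumset[OF A(3)])
  have "q * N \<le> (int h - 1) * N" using n n_eq r by linarith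
  then have qh: "q \<le> int h - 1" using N by simp
  show ?thesis
  proof (cases "r = 0")
    case True
    then have "n \<in> hfold_sumset (nat q) A"
      using mult[of "nat q"] \<open>q \<ge> 1\<close> n_eq by simp
    then show ?thesis
      using hfold_sumset_mono_fold[OF A(2), of "nat q" h] qh by (auto simp: nat_le_iff)
  next
    case False
    then have "q * N < (int h - 1) * N" using n n_eq r by linarith
    then have qh: "q < int h - 1" using N by simp
    obtain m where m: "m \<in> hfold_sumset 2 A" "m mod N = r"
      using mod_hfold_sumset_2_eq_atLeastLessThan[OF A N] r by (metis atLeastLessThan_iff image_iff)
    define p where "p = m div N"
    have m_eq: "m = p * N + r" using m(2) by (simp add: p_def flip: m(2))
    have m0: "0 \<le> m" "m \<le> 2 * N" using hfold_sumset_subset_atLeastAtMost[OF A(1), of 2] m(1) by auto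
    have "0 \<le> p" using m0 N by (simp add: p_def pos_imp_zdiv_nonneg_iff)
    moreover have "p * N < 2 * N" using m0 m_eq r False by linarith
    then have "p < 2" using N by simp
    ultimately have c: "0 \<le> q - p" "nat (q - p) + 2 \<le> h" using qh \<open>q \<ge> 1\<close> by auto
    have "int (nat (q - p)) * N + m \<in> hfold_sumset (nat (q - p) + 2) A"
      by (rule hfold_sumset_add[OF mult m(1)])
    moreover have "int (nat (q - p)) * N + m = n"
      using c n_eq m_eq by (simp add: algebra_simps)
    ultimately show ?thesis using hfold_sumset_mono_fold[OF A(2) c(2)] by auto
  qed
qed

lemma card_hfold_sumset_add_gaps:
  assumes A: "A \<subseteq> {0..N}" "0 \<in> A" "N \<in> A" and N: "0 < N" "N < 2 * int (card A) - 2"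
    and h: "h \<ge> 2"
  shows "int (card (hfold_sumset h A)) + int (card (low_gaps h N A))
           + int (card (low_gaps h N ((\<lambda>a. N - a) ` A))) = int h * N + 1"
proof -
  let ?H = "hfold_sumset h A" and ?L = "low_gaps h N A"
  let ?U = "(\<lambda>n. int h * N - n) ` low_gaps h N ((\<lambda>a. N - a) ` A)"
  have fA: "finite A" using A(1) finite_subset by blast
  have U: "?U = {(int h - 1) * N..int h * N} - ?H"
  proof -
    have "inj ((-) (int h * N))" by (auto simp: inj_on_def)
    then show ?thesis
      unfolding low_gaps_def hfold_sumset_reflect
      by (simp add: image_set_diff image_image algebra_simps)
  qed
  \<comment> \<open>For h = 2 the lower and upper ranges share the point \<open>N\<close>; since it
    belongs to the sumset, no gap is counted twice.\<close>
  have "N \<in> ?H" "(int h - 1) * N \<in> ?H"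
  proof -
    have "N \<le> (int h - 1) * N" using N h by (simp add: mult_le_cancel_right1)
    then show "N \<in> ?H" "(int h - 1) * N \<in> ?H"
      using middle_mem_hfold_sumset[OF A N] by auto
  qed
  then have strict: "\<forall>n\<in>?L. n < N" "\<forall>n\<in>?U. (int h - 1) * N < n"
    unfolding U by (auto simp: low_gaps_def le_less)
  have "N \<le> (int h - 1) * N" using N h by (simp add: mult_le_cancel_right1)
  then have disj: "?L \<inter> ?U = {}" using strict by fastforce
  have sub: "?H \<subseteq> {0..int h * N}" by (rule hfold_sumset_subset_atLeastAtMost[OF A(1)])
  have "n \<in> ?H \<union> (?L \<union> ?U)" if "n \<in> {0..int h * N}" for n
  proof (cases "n < N \<or> (int h - 1) * N < n")
    case True
    with that show ?thesis unfolding U by (auto simp: low_gaps_def)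
  next
    case False
    then have "n \<in> ?H" by (intro middle_mem_hfold_sumset[OF A N]) auto
    then show ?thesis by blast
  qed
  moreover have "?L \<union> ?U \<subseteq> {0..int h * N}"
  proof -
    have "N \<le> int h * N" "0 \<le> (int h - 1) * N" using N h by (simp_all add: mult_le_cancel_right1)
    then show ?thesis unfolding U by (auto simp: low_gaps_def)
  qed
  ultimately have "{0..int h * N} = ?H \<union> (?L \<union> ?U)" using sub by blast
  moreover have "?H \<inter> (?L \<union> ?U) = {}" unfolding U by (auto simp: low_gaps_def)
  moreover have "finite ?L" "finite ?U" unfolding U by (auto simp: low_gaps_def)
  ultimately have "card {0..int h * N} = card ?H + (card ?L + card ?U)"
    using disj fA by (simp add: card_Un_disjoint)
  moreover have "card ?U = card (low_gaps h N ((\<lambda>a. N - a) ` A))"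
    by (rule card_image) (auto simp: inj_on_def)
  moreover have "int (card {0..int h * N}) = int h * N + 1" using N by simp
  ultimately show ?thesis by linarith
qed

lemma low_gaps_Diff:
  assumes "S \<subseteq> {0<..N}" "N \<ge> 0" "h \<ge> 1"
  shows "low_gaps h N ({0..N} - S) = {n \<in> S. n \<notin> hfold_sumset h ({0..N} - S)}"
proof -
  have "{0..N} - S \<subseteq> hfold_sumset h ({0..N} - S)"
    using hfold_sumset_mono_fold[of "{0..N} - S" "Suc 0" h] assms
    by (metis DiffI One_nat_def atLeastAtMost_iff greaterThanAtMost_iff hfold_sumset_1 order_refl
        order_less_irrefl subsetD)
  moreover have "S \<subseteq> {0..N}" using assms(1) by force
  ultimately show ?thesis unfolding low_gaps_def by blast
qed

text \<open>If the nonnegative integers outside \<open>L\<close> are closed under addition, sums of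
  elements of \<open>A\<close> avoid \<open>L\<close> for any number of summands.\<close>

lemma low_gaps_eqI:
  assumes A: "A \<subseteq> {0..N}" and L: "L \<subseteq> {0..N}" "L \<inter> A = {}" "0 \<notin> L"
    and closed: "\<And>x y. 0 < x \<Longrightarrow> 0 < y \<Longrightarrow> x \<notin> L \<Longrightarrow> y \<notin> L \<Longrightarrow> x + y \<notin> L"
    and mem: "\<And>n. n \<in> {0..N} \<Longrightarrow> n \<notin> L \<Longrightarrow> n \<in> hfold_sumset h A"
  shows "low_gaps h N A = L"
proof -
  have cl: "x + y \<notin> L" if "0 \<le> x" "0 \<le> y" "x \<notin> L" "y \<notin> L" for x y
    using closed[of x y] that by (cases "x = 0 \<or> y = 0") auto
  have "hfold_sumset h A \<subseteq> {0..} - L"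
    by (rule hfold_sumset_add_closed) (use A L cl in auto)
  then show ?thesis using L mem by (auto simp: low_gaps_def)
qed

lemma mem_hfold_sumset_2I:
  assumes "0 \<in> A" "h \<ge> 2" "a \<in> A" "n - a \<in> A"
  shows "n \<in> hfold_sumset h A"
proof -
  have "n = a + (n - a)" by simp
  then have "n \<in> hfold_sumset 2 A" unfolding hfold_sumset_2 using assms by blast
  then show ?thesis using hfold_sumset_mono_fold assms by blast
qed

text \<open>The number of gaps below $N$ of $hA$ for $A = [0, N] \setminus \{x, y, z\}$. For $x = 1$ the gaps do
  not depend on $h$; otherwise $1 \in A$, and gaps occur only for $h \le 3$.\<close>
definition triple_gaps :: "nat \<Rightarrow> int \<Rightarrow> int \<Rightarrow> int \<Rightarrow> nat" where
  "triple_gaps h x y z =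
     (if x = 1 then
        if y = 2 then (if z \<le> 5 then 3 else 2)
        else if y = 3 then (if z = 5 then 3 else 2)
        else 1
      else if h = 2 then
        if x = 2 \<and> y = 3 then (if z = 4 then 2 else 1)
        else if y = 4 \<and> z = 5 then 1
        else 0
      else if h = 3 \<and> x = 2 \<and> y = 3 \<and> z = 4 then 1
      else 0)"

text \<open>The analogous count for two missing elements. If 1 is present, the only possible gap is
  3, when 2 and 3 are missing and just two summands are allowed.\<close>

definition pair_gaps :: "nat \<Rightarrow> int \<Rightarrow> int \<Rightarrow> nat" where
  "pair_gaps h x y =
     (if x = 1 then (if y \<le> 3 then 2 else 1)
      else if h = 2 \<and> x = 2 \<and> y = 3 then 1 else 0)"

text \<open>The possible gap sets are those of the numerical semigroups of genus 1 to 3: {1}, {1,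
  2}, {1, 3}, {1, 2, 3}, {1, 2, 4}, {1, 2, 5}, {1, 3, 5}. Any other missing element is a sum of two
  present ones.\<close>

lemma card_low_gaps_triple_1:
  assumes N: "N \<ge> 7" and yz: "1 < y" "y < z" "z < N" and h: "h \<ge> 2"
  shows "card (low_gaps h N ({0..N} - {1, y, z})) = triple_gaps h 1 y z"
proof -
  let ?A = "{0..N} - {1, y, z}"
  have two: "n \<in> hfold_sumset h ?A" if "a \<in> ?A" "n - a \<in> ?A" for n a
    by (rule mem_hfold_sumset_2I[of ?A h a]) (use yz h that in auto)
  have mem: "n \<in> hfold_sumset h ?A" if "n \<in> ?A" for n
    using two[of 0 n] that yz by simp
  consider (a) "y = 2" "z \<le> 5" | (b) "y = 2" "z > 5" | (c) "y = 3" "z = 5"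
    | (d) "y = 3" "z \<noteq> 5" | (e) "y > 3" using yz by linarith
  then show ?thesis
  proof cases
    case a
    have "low_gaps h N ?A = {1, 2, z}"
      by (rule low_gaps_eqI) (use a yz N mem in auto)
    then show ?thesis using a yz by (simp add: triple_gaps_def)
  next
    case b
    have "z \<in> hfold_sumset h ?A" by (rule two[of 3]) (use b yz N in auto)
    then have "low_gaps h N ?A = {1, 2}"
      by (intro low_gaps_eqI) (use b yz N mem in auto)
    then show ?thesis using b yz by (simp add: triple_gaps_def)
  next
    case c
    have "low_gaps h N ?A = {1, 3, 5}"
      by (rule low_gaps_eqI) (use c yz N mem in auto)
    then show ?thesis using c yz by (simp add: triple_gaps_def)
  next
    case d
    have "z \<in> hfold_sumset h ?A" by (rule two[of 2]) (use d yz N in auto)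
    then have "low_gaps h N ?A = {1, 3}"
      by (intro low_gaps_eqI) (use d yz N mem in auto)
    then show ?thesis using d yz by (simp add: triple_gaps_def)
  next
    case e
    have "y \<in> hfold_sumset h ?A" by (rule two[of 2]) (use e yz N in auto)
    moreover have "z \<in> hfold_sumset h ?A"
    \<comment> \<open>The decomposition \<open>2 + (z - 2)\<close> fails exactly when
      \<open>z - 2\<close> is the missing \<open>y\<close>; then 3 replaces 2.\<close>
    proof (cases "z = y + 2")
      case True
      then show ?thesis by (intro two[of 3]) (use e yz N in auto)
    next
      case False
      then show ?thesis by (intro two[of 2]) (use e yz N in auto)
    qed
    ultimately have "low_gaps h N ?A = {1}"
      by (intro low_gaps_eqI) (use e yz N mem in auto)
    then show ?thesis using e yz by (simp add: triple_gaps_def)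
  qed
qed

text \<open>Now 1 is present. At worst the missing elements are consecutive, and repeatedly adding 1
  reaches \<open>x\<close>, \<open>y\<close>, \<open>z\<close> with 2, 3, 4 summands; so gaps need h
  <= 3.\<close>

lemma card_low_gaps_triple:
  assumes N: "N \<ge> 7" and xyz: "1 < x" "x < y" "y < z" "z < N" and h: "h \<ge> 2"
  shows "card (low_gaps h N ({0..N} - {x, y, z})) = triple_gaps h x y z"
proof -
  let ?A = "{0..N} - {x, y, z}"
  let ?H = "\<lambda>h. hfold_sumset h ?A"
  have A0: "0 \<in> ?A" "1 \<in> ?A" using xyz by auto
  have mono: "?H g \<subseteq> ?H h" if "g \<le> h" for g h by (rule hfold_sumset_mono_fold[OF A0(1) that])
  have two: "n \<in> ?H 2" if "a \<in> ?A" "n - a \<in> ?A" for n a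
    by (rule mem_hfold_sumset_2I[OF A0(1) _ that]) simp
  have suc: "n \<in> ?H (Suc g)" if "n - a \<in> ?H g" "a \<in> ?A" for n a g
    using that unfolding hfold_sumset_Suc by force
  have mem: "n \<in> ?H h" if "n \<in> ?A" for n using that mono[of 1 h] h by auto
  have x2: "x \<in> ?H 2" by (rule two[of 1]) (use xyz in auto)
  have y3: "y \<in> ?H 3"
  proof (cases "y = x + 1")
    case True
    then show ?thesis using suc[of y 1 2] A0 x2 by simp
  next
    case False
    then have "y \<in> ?H 2" by (intro two[of 1]) (use xyz in auto)
    then show ?thesis using mono[of 2 3] by auto
  qed
  have gaps: "low_gaps h N ?A = {n \<in> {x, y, z}. n \<notin> ?H h}"
    by (rule low_gaps_Diff) (use xyz h in auto)
  have neq: "x \<noteq> y" "y \<noteq> z" "x \<noteq> z" using xyz by auto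
  consider "h = 2" | "h = 3" | "h \<ge> 4" using h by linarith
  then show ?thesis
  proof cases
    case 1
    have y2: "y \<in> ?H 2 \<longleftrightarrow> \<not> (x = 2 \<and> y = 3)"
    proof (cases "x = 2 \<and> y = 3")
      case True
      then show ?thesis by (auto simp: hfold_sumset_2)
    next
      case False
      then show ?thesis
        using two[of 1 y] two[of 2 y] xyz by (cases "y = x + 1") auto
    qed
    \<comment> \<open>For y = 4, z = 5 the missing \<open>x\<close> is 2 or 3, which blocks both 1 +
      4 and 2 + 3.\<close>
    have z2: "z \<in> ?H 2 \<longleftrightarrow> \<not> (x = 2 \<and> y = 3 \<and> z = 4) \<and> \<not> (y = 4 \<and> z = 5)"
    proof (cases "(x = 2 \<and> y = 3 \<and> z = 4) \<or> (y = 4 \<and> z = 5)")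
      case True
      then have "x \<in> {2, 3}" using xyz by auto
      with True show ?thesis by (auto simp: hfold_sumset_2)
    next
      case False
      consider "z \<noteq> y + 1" | "z = y + 1" "x \<noteq> 2" "x \<noteq> y - 1"
        | "z = y + 1" "x = 2 \<or> x = y - 1" by blast
      then have "z \<in> ?H 2"
      proof cases
        case 1
        then show ?thesis by (intro two[of 1]) (use xyz in auto)
      next
        case 2
        then show ?thesis by (intro two[of 2]) (use xyz in auto)
      next
        case 3
        then show ?thesis by (intro two[of 3]) (use False xyz in auto)
      qed
      with False show ?thesis by blast
    qed
    have "low_gaps h N ?A = {n \<in> {x, y, z}. (n = y \<and> x = 2 \<and> y = 3)
        \<or> (n = z \<and> (x = 2 \<and> y = 3 \<and> z = 4 \<or> y = 4 \<and> z = 5))}"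
      unfolding gaps[unfolded 1] 1 by (intro Collect_cong) (use x2 y2 z2 neq in blast)
    also have "\<dots> = (if x = 2 \<and> y = 3 then if z = 4 then {3, 4} else {3}
        else if y = 4 \<and> z = 5 then {5} else {})"
      using xyz by auto
    finally show ?thesis using xyz 1 by (simp add: triple_gaps_def)
  next
    case 2
    \<comment> \<open>If 2, 3, 4 are missing, only 0 and 1 can contribute to 4, so four summands are
      required.\<close>
    have z3: "z \<in> ?H 3 \<longleftrightarrow> \<not> (x = 2 \<and> y = 3 \<and> z = 4)"
    proof (cases "x = 2 \<and> y = 3 \<and> z = 4")
      case True
      then show ?thesis by (auto simp: hfold_sumset_3)
    next
      case False
      consider "z \<noteq> y + 1" | "z = y + 1" "y \<noteq> x + 1" | "z = y + 1" "y = x + 1" "x \<ge> 3"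
        using False xyz by linarith
      then have "z \<in> ?H 3"
      proof cases
        case 1
        then have "z \<in> ?H 2" by (intro two[of 1]) (use xyz in auto)
        then show ?thesis using mono[of 2 3] by auto
      next
        case 2
        then have "y \<in> ?H 2" by (intro two[of 1]) (use xyz in auto)
        then show ?thesis using suc[of z 1 2] A0 2 by simp
      next
        case 3
        then have "2 \<in> ?A" using xyz by auto
        then show ?thesis using suc[of z 2 2] x2 3 by simp
      qed
      with False show ?thesis by simp
    qed
    have "low_gaps h N ?A = (if x = 2 \<and> y = 3 \<and> z = 4 then {4} else {})"
      unfolding gaps[unfolded 2] 2 using x2 mono[of 2 3] y3 z3 by auto
    then show ?thesis using xyz 2 by (simp add: triple_gaps_def)
  next
    case 3
    have "z \<in> ?H 4"
    proof (cases "z = y + 1")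
      case True
      then show ?thesis using suc[of z 1 3] A0 y3 by simp
    next
      case False
      then have "z \<in> ?H 2" by (intro two[of 1]) (use xyz in auto)
      then show ?thesis using mono[of 2 4] by auto
    qed
    then have "low_gaps h N ?A = {}"
      unfolding gaps using x2 y3 mono[of 2 h] mono[of 3 h] mono[of 4 h] 3 by auto
    then show ?thesis using xyz 3 by (simp add: triple_gaps_def)
  qed
qed

lemma card_low_gaps_pair:
  assumes N: "N \<ge> 6" and xy: "0 < x" "x < y" "y < N" and h: "h \<ge> 2"
  shows "card (low_gaps h N ({0..N} - {x, y})) = pair_gaps h x y"
proof -
  let ?A = "{0..N} - {x, y}"
  have two: "n \<in> hfold_sumset h ?A" if "a \<in> ?A" "n - a \<in> ?A" for n a
    by (rule mem_hfold_sumset_2I[of ?A h a]) (use xy h that in auto)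
  have mem: "n \<in> hfold_sumset h ?A" if "n \<in> ?A" for n
    using two[of 0 n] that xy by simp
  consider (a) "x = 1" "y \<le> 3" | (b) "x = 1" "y > 3" | (c) "x = 2" "y = 3" "h = 2"
    | (d) "x = 2" "y = 3" "h \<ge> 3" | (e) "x > 1" "\<not> (x = 2 \<and> y = 3)" using xy h by linarith
  then show ?thesis
  proof cases
    case a
    have "low_gaps h N ?A = {1, y}"
      by (rule low_gaps_eqI) (use a xy N mem in auto)
    then show ?thesis using a xy by (simp add: pair_gaps_def)
  next
    case b
    have "y \<in> hfold_sumset h ?A" by (rule two[of 2]) (use b xy N in auto)
    then have "low_gaps h N ?A = {1}"
      by (intro low_gaps_eqI) (use b xy N mem in auto)
    then show ?thesis using b xy by (simp add: pair_gaps_def)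
  next
    case c
    have "2 \<in> hfold_sumset h ?A" by (rule two[of 1]) (use c N in auto)
    moreover have "3 \<notin> hfold_sumset h ?A" using c by (auto simp: hfold_sumset_2)
    ultimately have "low_gaps h N ?A = {3}"
      using low_gaps_Diff[of "{2, 3}" N h] c N by auto
    then show ?thesis using c by (simp add: pair_gaps_def)
  next
    case d
    have "2 \<in> hfold_sumset h ?A" by (rule two[of 1]) (use d N in auto)
    moreover have "1 + 1 + 1 \<in> hfold_sumset 3 ?A"
      unfolding hfold_sumset_3 using d N by (intro CollectI exI[of _ 1]) auto
    then have "3 \<in> hfold_sumset h ?A"
      using hfold_sumset_mono_fold[of ?A 3 h] d N by auto
    ultimately have "low_gaps h N ?A = {}"
      using low_gaps_Diff[of "{2, 3}" N h] d N by auto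
    then show ?thesis using d by (simp add: pair_gaps_def)
  next
    case e
    have "x \<in> hfold_sumset h ?A" by (rule two[of 1]) (use e xy in auto)
    moreover have "y \<in> hfold_sumset h ?A"
    proof (cases "y = x + 1")
      case True
      then show ?thesis by (intro two[of 2]) (use e xy N in auto)
    next
      case False
      then show ?thesis by (intro two[of 1]) (use e xy N in auto)
    qed
    ultimately have "low_gaps h N ?A = {}"
      using low_gaps_Diff[of "{x, y}" N h] xy h by auto
    then show ?thesis using e xy by (simp add: pair_gaps_def)
  qed
qed

section \<open>Cardinality for sets of small diameter\<close>

lemma reflect_Diff_triple:
  "(\<lambda>a. N - a) ` ({0..N} - {x, y, z}) = {0..N::int} - {N - z, N - y, N - x}"
proof -
  have "inj ((-) N)" by (auto simp: inj_on_def)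
  then show ?thesis by (simp add: image_set_diff insert_commute)
qed

lemma reflect_Diff_pair:
  "(\<lambda>a. N - a) ` ({0..N} - {x, y}) = {0..N::int} - {N - y, N - x}"
proof -
  have "inj ((-) N)" by (auto simp: inj_on_def)
  then show ?thesis by (simp add: image_set_diff insert_commute)
qed

lemma card_hfold_sumset_Diff_triple:
  assumes N: "N \<ge> 7" and xyz: "0 < x" "x < y" "y < z" "z < N" and h: "h \<ge> 2"
  shows "int (card (hfold_sumset h ({0..N} - {x, y, z})))
           + int (triple_gaps h x y z + triple_gaps h (N - z) (N - y) (N - x)) = int h * N + 1"
proof -
  let ?A = "{0..N} - {x, y, z}"
  have "int (card ?A) = N - 2" using xyz by (simp add: card_Diff_subset)
  then have "int (card (hfold_sumset h ?A)) + int (card (low_gaps h N ?A))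
      + int (card (low_gaps h N ((\<lambda>a. N - a) ` ?A))) = int h * N + 1"
    using N xyz h by (intro card_hfold_sumset_add_gaps) auto
  moreover have gaps: "card (low_gaps h N ({0..N} - {u, v, w})) = triple_gaps h u v w"
    if "0 < u" "u < v" "v < w" "w < N" for u v w
    using card_low_gaps_triple_1[OF N _ _ _ h] card_low_gaps_triple[OF N _ _ _ _ h] that
    by (cases "u = 1") auto
  ultimately show ?thesis
    using xyz by (simp add: reflect_Diff_triple)
qed

lemma card_hfold_sumset_Diff_pair:
  assumes N: "N \<ge> 6" and xy: "0 < x" "x < y" "y < N" and h: "h \<ge> 2"
  shows "int (card (hfold_sumset h ({0..N} - {x, y})))
           + int (pair_gaps h x y + pair_gaps h (N - y) (N - x)) = int h * N + 1"
proof -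
  let ?A = "{0..N} - {x, y}"
  have "int (card ?A) = N - 1" using xy by (simp add: card_Diff_subset)
  then have "int (card (hfold_sumset h ?A)) + int (card (low_gaps h N ?A))
      + int (card (low_gaps h N ((\<lambda>a. N - a) ` ?A))) = int h * N + 1"
    using N xy h by (intro card_hfold_sumset_add_gaps) auto
  then show ?thesis
    using xy card_low_gaps_pair[OF N _ _ _ h] by (simp add: reflect_Diff_pair)
qed

lemma card_hfold_sumset_le:
  assumes "A \<subseteq> {0..d}" "d \<ge> 0"
  shows "int (card (hfold_sumset h A)) \<le> int h * d + 1"
proof -
  have "card (hfold_sumset h A) \<le> card {0..int h * d}"
    by (intro card_mono hfold_sumset_subset_atLeastAtMost assms) auto
  also have "int \<dots> = int h * d + 1" using assms by simp
  finally show ?thesis by simp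
qed

section \<open>The triple of missing elements\<close>

lemma triple_eq_iff:
  fixes x y z a b c :: int
  assumes "x < y" "y < z" "a < b" "b < c"
  shows "{x, y, z} = {a, b, c} \<longleftrightarrow> x = a \<and> y = b \<and> z = c"
proof
  assume *: "{x, y, z} = {a, b, c}"
  then have "x \<in> {a, b, c}" "y \<in> {a, b, c}" "z \<in> {a, b, c}" by blast+
  with assms show "x = a \<and> y = b \<and> z = c" by auto
qed simp

text \<open>The quantified elements need not be distinct or lie in the interval. But they must
  include the three actual missing elements, and three names leave no room for more.\<close>

lemma ex_Diff_triple_iff:
  fixes x y z :: int
  assumes "x < y" "y < z" "{x, y, z} \<subseteq> {0..N}"
  shows "(\<exists>x' y' z'. {0..N} - {x, y, z} = {0..N} - {x', y', z'} \<and> Q {x', y', z'}) \<longleftrightarrow> Q {x, y, z}"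
proof
  assume "\<exists>x' y' z'. {0..N} - {x, y, z} = {0..N} - {x', y', z'} \<and> Q {x', y', z'}"
  then obtain x' y' z' where *: "{0..N} - {x, y, z} = {0..N} - {x', y', z'}" "Q {x', y', z'}"
    by blast
  have "{x, y, z} \<subseteq> {x', y', z'}" using *(1) assms(3) by blast
  moreover have "card {x', y', z'} \<le> card {x, y, z}"
    using assms by (simp add: card_insert_if)
  ultimately have "{x, y, z} = {x', y', z'}" by (intro card_seteq) auto
  with * show "Q {x, y, z}" by simp
qed blast

text \<open>The ambient interval is the same for every maximum up to k + 2. A smaller maximum shows
  up as a triple ending in k + 2, the source of such triples in the first two equivalences.\<close>

lemma obtain_Diff_triple:
  fixes A :: "int set"
  assumes "A \<subseteq> {0..int k + 2}" "card A = k" "0 \<in> A"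
  obtains x y z where "0 < x" "x < y" "y < z" "z \<le> int k + 2" "A = {0..int k + 2} - {x, y, z}"
proof -
  let ?S = "{0..int k + 2} - A"
  have "finite A" using assms(1) finite_subset by blast
  then have "card ?S = 3" using assms by (simp add: card_Diff_subset)
  obtain xs where xs: "sorted xs" "distinct xs" "set xs = ?S" "length xs = 3"
    using finite_sorted_distinct_unique[of ?S] \<open>card ?S = 3\<close> by (metis distinct_card finite_Diff finite_atLeastAtMost_int)
  then have "sorted_wrt (<) xs" by (simp add: strict_sorted_iff)
  with xs(4) obtain x y z where xyz: "xs = [x, y, z]" "x < y" "y < z"
    by (auto simp: numeral_eq_Suc length_Suc_conv)
  then have S: "?S = {x, y, z}" using xs(3) by simp
  then have "A = {0..int k + 2} - {x, y, z}" using assms(1) by blast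
  moreover have "x \<in> ?S" "z \<in> ?S" using S by blast+
  then have "0 < x" "z \<le> int k + 2" using assms(3) by (auto simp: le_less)
  ultimately show ?thesis using that xyz by blast
qed

text \<open>As a rewrite rule this puts the range conditions of a family first, so that conj_cong makes them
  available to discharge the ordering premises of triple_eq_iff.\<close>
lemma conj_triple_commute: "({x, y, z} = T \<and> P) = (P \<and> {x, y, z} = T)" for x y z :: int
  by blast

lemmas triple_mem_simps = conj_triple_commute triple_eq_iff

lemma normalized_of_diff_gcd:
  assumes "finite A" "A \<noteq> {}" "Min A = 0" "diff_gcd A = 1"
  shows "normalized A (Max A)"
proof -
  have "Gcd (A - {0}) = 1" using assms(3,4) by (simp add: diff_gcd_def)
  moreover have "0 \<in> A" using Min_in[OF assms(1,2)] assms(3) by simp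
  then have "Gcd A = Gcd (A - {0})" using Gcd_insert[of 0 "A - {0}"] by (simp add: insert_absorb)
  moreover have "A \<subseteq> {0..Max A}" using assms Min_le[OF assms(1)] by auto
  ultimately show ?thesis
    using \<open>0 \<in> A\<close> Max_in[OF assms(1,2)] by (simp add: normalized_def)
qed

lemma ex_Diff_triple_sorted_iff:
  fixes x y z :: int
  assumes "x < y" "y < z" "{x, y, z} \<subseteq> {0..N}"
  shows "(\<exists>x' y' z'. {0..N} - {x, y, z} = {0..N} - {x', y', z'}
            \<and> a \<le> x' \<and> x' < y' \<and> y' < z' \<and> z' \<le> b) \<longleftrightarrow> a \<le> x \<and> z \<le> b"
proof
  assume "\<exists>x' y' z'. {0..N} - {x, y, z} = {0..N} - {x', y', z'}
            \<and> a \<le> x' \<and> x' < y' \<and> y' < z' \<and> z' \<le> b"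
  then obtain x' y' z' where *: "{0..N} - {x, y, z} = {0..N} - {x', y', z'}"
    "a \<le> x'" "x' < y'" "y' < z'" "z' \<le> b" by (elim exE conjE)
  have "{x, y, z} = {x', y', z'}"
  proof (rule iffD1[OF ex_Diff_triple_iff[OF assms, of "\<lambda>S. S = {x', y', z'}"]])
    show "\<exists>u v w. {0..N} - {x, y, z} = {0..N} - {u, v, w} \<and> {u, v, w} = {x', y', z'}"
      using *(1) by (intro exI[of _ x'] exI[of _ y'] exI[of _ z'] conjI refl)
  qed
  then show "a \<le> x \<and> z \<le> b"
    using triple_eq_iff[OF assms(1,2) *(3,4)] * by simp
qed (use assms in \<open>intro exI[of _ x] exI[of _ y] exI[of _ z], simp\<close>)

theorem theorem1p7:
  fixes h k :: nat and A :: "int set"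
  assumes "h \<ge> 2" and "k \<ge> 5"
    and "finite A" and "card A = k" and "Min A = 0" and "diff_gcd A = 1"
  shows
   "(k \<ge> 6 \<longrightarrow>
      (card (hfold_sumset 2 A) = 2 * k + 2 \<longleftrightarrow>
        (\<exists>x y z. A = {0..int k + 2} - {x, y, z} \<and>
          {x, y, z} \<in>
            {{2, 3, int k + 2}, {int k - 2, int k - 1, int k + 2}}
            \<union> {{1, i, int k + 2} | i. 4 \<le> i \<and> i \<le> int k - 1}
            \<union> {{i, int k, int k + 2} | i. 2 \<le> i \<and> i \<le> int k - 3}
            \<union> {{1, 2, 3}, {int k - 1, int k, int k + 1},
               {1, 2, 4}, {int k - 2, int k, int k + 1},
               {1, 2, int k + 1}, {1, int k, int k + 1},
               {1, 2, 5}, {int k - 3, int k, int k + 1},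
               {1, 3, 5}, {int k - 3, int k - 1, int k + 1},
               {1, 3, int k + 1}, {1, int k - 1, int k + 1},
               {2, 3, int k + 2}})))
    \<and>
    (card (hfold_sumset 3 A) = 3 * k + 4 \<longleftrightarrow>
      (\<exists>x y z. A = {0..int k + 2} - {x, y, z} \<and>
        {x, y, z} \<in>
          {{1, 2, 3}, {int k - 1, int k, int k + 1},
           {1, 2, 4}, {int k - 2, int k, int k + 1},
           {1, 2, int k + 1}, {1, int k, int k + 1},
           {1, 2, 5}, {int k - 3, int k, int k + 1},
           {1, 3, 5}, {int k - 3, int k - 1, int k + 1},
           {1, 3, int k + 1}, {1, int k - 1, int k + 1}}
          \<union> {{i, j, int k + 2} | i j. 2 \<le> i \<and> i < j \<and> j \<le> int k - 1}))
    \<and>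
    (h \<ge> 4 \<longrightarrow>
      (card (hfold_sumset h A) = h * k + 2 * h - 2 \<longleftrightarrow>
        (\<exists>x y z. A = {0..int k + 2} - {x, y, z} \<and>
          {x, y, z} \<in>
            {{1, 2, 3}, {int k - 1, int k, int k + 1},
             {1, 2, 4}, {int k - 2, int k, int k + 1},
             {1, 2, int k + 1}, {1, int k, int k + 1},
             {1, 2, 5}, {int k - 3, int k, int k + 1},
             {1, 3, 5}, {int k - 3, int k - 1, int k + 1},
             {1, 3, int k + 1}, {1, int k - 1, int k + 1}})))
    \<and>
    ((h \<ge> 4 \<and> k \<ge> 5) \<or> (h \<ge> 3 \<and> k \<ge> 6) \<longrightarrow>
      (card (hfold_sumset h A) = h * k + 2 * h - 1 \<longleftrightarrow>
        (\<exists>x y z. A = {0..int k + 2} - {x, y, z} \<and>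
          {x, y, z} \<in>
            {{1, 3, 4}, {int k - 2, int k - 1, int k + 1}}
            \<union> {{1, 2, i} | i. 6 \<le> i \<and> i \<le> int k}
            \<union> {{i, int k, int k + 1} | i. 2 \<le> i \<and> i \<le> int k - 4}
            \<union> {{1, 3, i} | i. 6 \<le> i \<and> i \<le> int k}
            \<union> {{i, int k - 1, int k + 1} | i. 2 \<le> i \<and> i \<le> int k - 4}
            \<union> {{1, i, int k + 1} | i. 4 \<le> i \<and> i \<le> int k - 2})))
    \<and>
    ((h \<ge> 4 \<and> k \<ge> 6) \<or> (h \<ge> 5 \<and> k \<ge> 5) \<longrightarrow>
      (card (hfold_sumset h A) = h * k + 2 * h \<longleftrightarrow>
        (\<exists>x y z. A = {0..int k + 2} - {x, y, z} \<and>
          {x, y, z} \<in>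
            {{2, 3, int k + 1}, {1, int k - 1, int k}}
            \<union> {{i, i + 1, int k + 1} | i. 3 \<le> i \<and> i \<le> int k - 3}
            \<union> {{1, i, i + 1} | i. 4 \<le> i \<and> i \<le> int k - 2}
            \<union> {{i, i + 2, int k + 1} | i. 2 \<le> i \<and> i \<le> int k - 4}
            \<union> {{1, i, i + 2} | i. 4 \<le> i \<and> i \<le> int k - 2}
            \<union> {{1, i, j} | i j. 4 \<le> i \<and> i \<le> j - 3 \<and> j - 3 \<le> int k - 3}
            \<union> {{i, j, int k + 1} | i j. 2 \<le> i \<and> i \<le> j - 3 \<and> j - 3 \<le> int k - 5})))
    \<and>
    ((h \<ge> 5 \<and> k \<ge> 6) \<or> (h \<ge> 6 \<and> k \<ge> 5) \<longrightarrow>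
      (card (hfold_sumset h A) = h * k + 2 * h + 1 \<longleftrightarrow>
        (\<exists>x y z. A = {0..int k + 2} - {x, y, z} \<and>
          2 \<le> x \<and> x < y \<and> y < z \<and> z \<le> int k)))"
proof -
  have "A \<noteq> {}" using assms(2,4) by auto
  with assms have norm: "normalized A (Max A)" by (intro normalized_of_diff_gcd)
  note A = normalizedD[OF norm]
  show ?thesis
  proof (cases "Max A \<le> int k + 2")
    case False
    \<comment> \<open>Here the maximum lies outside [0, k + 2], so every right-hand side is false,
      and the lower bounds refute the left-hand sides.\<close>
    then have no_triple: "A = {0..int k + 2} - {x, y, z} \<longleftrightarrow> False" for x y z
      using A(4) by auto
    have ge: "card (hfold_sumset g A) + 4 \<ge> g * k + 3 * g"
      "k \<ge> 6 \<Longrightarrow> card (hfold_sumset g A) + 3 \<ge> g * k + 3 * g" if "g \<ge> 2" for g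
      using card_hfold_sumset_ge[OF norm _ _ that] False assms by auto
    have ge_h: "card (hfold_sumset h A) + 4 \<ge> h * k + 3 * h"
      "k \<ge> 6 \<Longrightarrow> card (hfold_sumset h A) + 3 \<ge> h * k + 3 * h"
      using ge[of h] assms(1) by auto
    show ?thesis
      unfolding no_triple simp_thms ex_simps
      by (intro conjI impI notI) (use ge_h ge[of 2] ge[of 3] in linarith)+
  next
    case True
    then have sub: "A \<subseteq> {0..int k + 2}" using A(2) by auto
    obtain x y z where xyz: "0 < x" "x < y" "y < z" "z \<le> int k + 2"
      and A_eq: "A = {0..int k + 2} - {x, y, z}"
      using obtain_Diff_triple[OF sub assms(4) A(3)] by blast
    have in_range: "{x, y, z} \<subseteq> {0..int k + 2}" using xyz by auto
    note ex = ex_Diff_triple_iff[OF xyz(2,3) in_range, of "\<lambda>S. S \<in> F" for F, folded A_eq]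
      ex_Diff_triple_sorted_iff[OF xyz(2,3) in_range, folded A_eq]
    \<comment> \<open>The three cases are maximum k + 2, maximum k + 1, and maximum at most
      k.\<close>
    consider (triple) "z < int k + 2" | (pair) "z = int k + 2" "y < int k + 1"
      | (single) "z = int k + 2" "y = int k + 1"
      using xyz by linarith
    then show ?thesis
    proof cases
      case triple
      let ?c = "\<lambda>g. triple_gaps g x y z + triple_gaps g (int k + 2 - z) (int k + 2 - y) (int k + 2 - x)"
      have card: "card (hfold_sumset g A) + ?c g = g * k + 2 * g + 1" if "g \<ge> 2" for g
      proof -
        have "int (card (hfold_sumset g A) + ?c g) = int (g * k + 2 * g + 1)"
          using card_hfold_sumset_Diff_triple[of "int k + 2" x y z g] xyz triple that assms(2)
          by (simp add: A_eq algebra_simps)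
        then show ?thesis by (simp only: of_nat_eq_iff)
      qed
      \<comment> \<open>The cardinality is hk + 2h + 1 minus the number of gaps, so the six
        equivalences ask for 3, 3, 3, 2, 1 and 0 gaps.\<close>
      have iff: "card (hfold_sumset 2 A) = 2 * k + 2 \<longleftrightarrow> ?c 2 = 3"
        "card (hfold_sumset 3 A) = 3 * k + 4 \<longleftrightarrow> ?c 3 = 3"
        "card (hfold_sumset h A) = h * k + 2 * h - 2 \<longleftrightarrow> ?c h = 3"
        "card (hfold_sumset h A) = h * k + 2 * h - 1 \<longleftrightarrow> ?c h = 2"
        "card (hfold_sumset h A) = h * k + 2 * h \<longleftrightarrow> ?c h = 1"
        "card (hfold_sumset h A) = h * k + 2 * h + 1 \<longleftrightarrow> ?c h = 0"
        using card[of 2] card[of 3] card[of h] assms(1) by auto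
      note order = xyz triple assms(1,2)
      show ?thesis
        unfolding ex iff
      proof (intro conjI impI, goal_cases)
        case 1
        with order show ?case
          by (simp add: triple_mem_simps cong: conj_cong) (auto simp: triple_gaps_def split: if_splits)
      next
        case 2
        with order show ?case
          by (simp add: triple_mem_simps cong: conj_cong) (auto simp: triple_gaps_def split: if_splits)
      next
        case 3
        with order show ?case
          by (simp add: triple_mem_simps cong: conj_cong) (auto simp: triple_gaps_def split: if_splits)
      next
        case 4
        show ?case
        proof (cases "h = 3")
          case True
          with 4 have "k \<ge> 6" by simp
          with order True show ?thesis
            by (simp add: triple_mem_simps cong: conj_cong) (auto simp: triple_gaps_def split: if_splits)
        next
          case False
          with 4 have "h \<ge> 4" by auto
          with order show ?thesis
            by (simp add: triple_mem_simps cong: conj_cong) (auto simp: triple_gaps_def split: if_splits)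
        qed
      next
        case 5
        then have "h \<ge> 4" by auto
        with order show ?case
          by (simp add: triple_mem_simps cong: conj_cong) (auto simp: triple_gaps_def split: if_splits)
      next
        case 6
        then have "h \<ge> 4" by auto
        with order show ?case
          by (auto simp: triple_gaps_def split: if_splits)
      qed
    next
      case pair
      let ?c = "\<lambda>g. pair_gaps g x y + pair_gaps g (int k + 1 - y) (int k + 1 - x)"
      have A_eq': "A = {0..int k + 1} - {x, y}" using pair xyz by (auto simp: A_eq)
      have card: "card (hfold_sumset g A) + ?c g = g * k + g + 1" if "g \<ge> 2" for g
      proof -
        have "int (card (hfold_sumset g A) + ?c g) = int (g * k + g + 1)"
          using card_hfold_sumset_Diff_pair[of "int k + 1" x y g] xyz pair that assms(2)
          by (simp add: A_eq' algebra_simps)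
        then show ?thesis by (simp only: of_nat_eq_iff)
      qed
      have iff: "card (hfold_sumset 2 A) = 2 * k + 2 \<longleftrightarrow> ?c 2 = 1"
        "card (hfold_sumset 3 A) = 3 * k + 4 \<longleftrightarrow> ?c 3 = 0"
        using card[of 2] card[of 3] by auto
      note order = xyz pair assms(1,2)
      show ?thesis
        unfolding ex iff
      proof (intro conjI impI, goal_cases)
        case 1
        with order show ?case
          by (simp add: triple_mem_simps cong: conj_cong) (auto simp: pair_gaps_def split: if_splits)
      next
        case 2
        with order show ?case
          by (simp add: triple_mem_simps cong: conj_cong) (auto simp: pair_gaps_def split: if_splits)
      \<comment> \<open>With maximum k + 1 the cardinality is at most hk + h + 1, below each value
        in the last four equivalences, and no triple listed there contains k + 2.\<close>
      qed (use order card[of h] in \<open>auto simp: triple_mem_simps cong: conj_cong\<close>)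
    next
      case single
      have "A \<subseteq> {0..int k}" using single by (auto simp: A_eq)
      \<comment> \<open>The bound gk + 1 is below every cardinality in question, and no listed
        triple contains both k + 1 and k + 2.\<close>
      then have card: "card (hfold_sumset g A) \<le> g * k + 1" for g
        using card_hfold_sumset_le[of A "int k" g] by (simp flip: of_nat_mult of_nat_Suc)
      note order = xyz single assms(1,2)
      show ?thesis
        unfolding ex
        by (intro conjI impI)
           (use order card[of 2] card[of 3] card[of h] in \<open>auto simp: triple_mem_simps cong: conj_cong\<close>)
    qed
  qed
qed

end
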